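(* Let $\Phi$ be a classical irreducible root system (type $\mathrm A$, $\mathrm B$, $\mathrm C$ or $\mathrm D$) with simple system $\Pi$, and let $\alpha\in\Pi$ be a leaf in the Dynkin diagram. Then the number of roots in $\Phi^+\setminus\Phi_\alpha$ having the same length as $\alpha$ is $$\frac{|W_\alpha|}{|W_{\widetilde N[\alpha]}|}.$$
   Context: $\Phi$ is finite, reduced and crystallographic, in a Euclidean space with Weyl-group-invariant form $(\cdot,\cdot)$; $\Phi^+$ is the set of positive roots with respect to $\Pi$. $\Phi_\alpha$ is the root subsystem generated by $\Pi\setminus\{\alpha\}$. For $X\subseteq\Pi$, $W_X$ is the subgroup of the Weyl group generated by the reflections $s_\beta$ with $\beta\in\Pi\setminus X$; $W_\alpha=W_{\{\alpha\}}$. $\widetilde N[\alpha]=\{\varepsilon\in\Pi:(\varepsilon,\alpha)\ne0\}$, i.e. $\alpha$ together with its neighbours in the Dynkin diagram. *)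

theory Defs
  imports
    "HOL-Analysis.Analysis"
    "HOL-Algebra.Generated_Groups"
    "HOL-Algebra.Bij"
begin

definition reflection :: "'a::real_inner \<Rightarrow> 'a \<Rightarrow> 'a" where
  "reflection \<beta> v = v - (2 * (v \<bullet> \<beta>) / (\<beta> \<bullet> \<beta>)) *\<^sub>R \<beta>"

text \<open>The Cartan number of \<open>\<beta>\<close> against the coroot of \<open>\<gamma>\<close>.\<close>

definition cartan_number :: "'a::real_inner \<Rightarrow> 'a \<Rightarrow> real" where
  "cartan_number \<beta> \<gamma> = 2 * (\<beta> \<bullet> \<gamma>) / (\<gamma> \<bullet> \<gamma>)"

text \<open>Finite, reduced, crystallographic root systems. The roots need not span the ambient
  Euclidean space, so that a root subsystem is again a root system (possibly empty) in the
  same space. The invariant form is the inner product.\<close>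

definition root_system :: "'a::euclidean_space set \<Rightarrow> bool" where
  "root_system \<Phi> \<longleftrightarrow>
     finite \<Phi> \<and> 0 \<notin> \<Phi> \<and>
     (\<forall>\<beta>\<in>\<Phi>. \<forall>\<gamma>\<in>\<Phi>. reflection \<beta> \<gamma> \<in> \<Phi>) \<and>
     (\<forall>\<beta>\<in>\<Phi>. \<forall>c. c *\<^sub>R \<beta> \<in> \<Phi> \<longrightarrow> c = 1 \<or> c = - 1) \<and>
     (\<forall>\<beta>\<in>\<Phi>. \<forall>\<gamma>\<in>\<Phi>. cartan_number \<beta> \<gamma> \<in> \<int>)"

definition irreducible_roots :: "'a::euclidean_space set \<Rightarrow> bool" where
  "irreducible_roots \<Phi> \<longleftrightarrow>
     \<Phi> \<noteq> {} \<and>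
     \<not> (\<exists>A B. A \<noteq> {} \<and> B \<noteq> {} \<and> A \<inter> B = {} \<and> A \<union> B = \<Phi> \<and> (\<forall>\<beta>\<in>A. \<forall>\<gamma>\<in>B. \<beta> \<bullet> \<gamma> = 0))"

definition nonneg_combination :: "'a::euclidean_space set \<Rightarrow> 'a \<Rightarrow> bool" where
  "nonneg_combination \<Delta> v \<longleftrightarrow> (\<exists>c :: 'a \<Rightarrow> nat. v = (\<Sum>\<delta>\<in>\<Delta>. real (c \<delta>) *\<^sub>R \<delta>))"

definition simple_system :: "'a::euclidean_space set \<Rightarrow> 'a set \<Rightarrow> bool" where
  "simple_system \<Phi> \<Delta> \<longleftrightarrow>
     \<Delta> \<subseteq> \<Phi> \<and> independent \<Delta> \<and>
     (\<forall>\<beta>\<in>\<Phi>. nonneg_combination \<Delta> \<beta> \<or> nonneg_combination \<Delta> (- \<beta>))"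

definition positive_roots :: "'a::euclidean_space set \<Rightarrow> 'a set \<Rightarrow> 'a set" where
  "positive_roots \<Phi> \<Delta> = {\<beta>\<in>\<Phi>. nonneg_combination \<Delta> \<beta>}"

definition generated_subsystem :: "'a::euclidean_space set \<Rightarrow> 'a set \<Rightarrow> 'a set" where
  "generated_subsystem \<Phi> X = (\<lambda>\<Psi>. root_system \<Psi> \<and> \<Psi> \<subseteq> \<Phi>) hull X"

text \<open>The subgroup \<open>W\<^sub>X\<close> is generated by the simple reflections \<^emph>\<open>outside\<close> \<open>X\<close>.\<close>

definition parabolic :: "'a::euclidean_space set \<Rightarrow> 'a set \<Rightarrow> ('a \<Rightarrow> 'a) set" where
  "parabolic \<Delta> X = generate (BijGroup UNIV) (reflection ` (\<Delta> - X))"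

definition closed_nbhd :: "'a::euclidean_space set \<Rightarrow> 'a \<Rightarrow> 'a set" where
  "closed_nbhd \<Delta> \<alpha> = {\<epsilon>\<in>\<Delta>. \<epsilon> \<bullet> \<alpha> \<noteq> 0}"

text \<open>A leaf has exactly one neighbour; the multiplicity of the bond is irrelevant.\<close>

definition dynkin_leaf :: "'a::euclidean_space set \<Rightarrow> 'a \<Rightarrow> bool" where
  "dynkin_leaf \<Delta> \<alpha> \<longleftrightarrow> \<alpha> \<in> \<Delta> \<and> card {\<epsilon>\<in>\<Delta>. \<epsilon> \<noteq> \<alpha> \<and> \<epsilon> \<bullet> \<alpha> \<noteq> 0} = 1"

text \<open>The classical Cartan matrices in Bourbaki's numbering, with indices \<open>1, \<dots>, n\<close>.
  In type B the last simple root is short, in type C it is long.\<close>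

definition cartan_A :: "nat \<Rightarrow> nat \<Rightarrow> int" where
  "cartan_A i j = (if i = j then 2 else if Suc i = j \<or> Suc j = i then - 1 else 0)"

definition cartan_B :: "nat \<Rightarrow> nat \<Rightarrow> nat \<Rightarrow> int" where
  "cartan_B n i j = (if Suc i = n \<and> j = n then - 2 else cartan_A i j)"

definition cartan_C :: "nat \<Rightarrow> nat \<Rightarrow> nat \<Rightarrow> int" where
  "cartan_C n i j = cartan_B n j i"

definition cartan_D :: "nat \<Rightarrow> nat \<Rightarrow> nat \<Rightarrow> int" where
  "cartan_D n i j =
     (if i = j then 2
      else if (i < n \<and> j < n \<and> (Suc i = j \<or> Suc j = i)) \<or> (i + 2 = n \<and> j = n) \<or> (i = n \<and> j + 2 = n)
      then - 1 else 0)"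

definition has_cartan_matrix ::
  "'a::euclidean_space set \<Rightarrow> nat \<Rightarrow> (nat \<Rightarrow> nat \<Rightarrow> int) \<Rightarrow> bool" where
  "has_cartan_matrix \<Delta> n C \<longleftrightarrow>
     (\<exists>\<sigma>. bij_betw \<sigma> {1..n} \<Delta> \<and>
          (\<forall>i\<in>{1..n}. \<forall>j\<in>{1..n}. cartan_number (\<sigma> i) (\<sigma> j) = of_int (C i j)))"

definition classical_type :: "'a::euclidean_space set \<Rightarrow> bool" where
  "classical_type \<Delta> \<longleftrightarrow>
     (\<exists>n\<ge>1. has_cartan_matrix \<Delta> n cartan_A) \<or>
     (\<exists>n\<ge>2. has_cartan_matrix \<Delta> n (cartan_B n)) \<or>
     (\<exists>n\<ge>2. has_cartan_matrix \<Delta> n (cartan_C n)) \<or>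
     (\<exists>n\<ge>4. has_cartan_matrix \<Delta> n (cartan_D n))"

end

theory Submission
  imports Defs
begin

text \<open>
  The quotient is the size of the orbit of \<open>\<alpha>\<close> under \<open>W\<^sub>\<alpha>\<close>: as \<open>-\<alpha>\<close> is dominant for \<open>\<Delta> - {\<alpha>}\<close>,
  its stabilizer in \<open>W\<^sub>\<alpha>\<close> is generated by the simple reflections orthogonal to \<open>\<alpha>\<close>. The orbit
  consists of all roots \<open>\<beta>\<close> of the same length as \<open>\<alpha>\<close> whose \<open>\<alpha>\<close>-coefficient is 1: if such a
  \<open>\<beta>\<close> has minimal height in its \<open>W\<^sub>\<alpha>\<close>-orbit, then \<open>(\<beta>,\<delta>) \<le> 0\<close> for every simple \<open>\<delta> \<noteq> \<alpha>\<close>, so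
  \<open>(\<beta>,\<beta>) \<le> (\<beta>,\<alpha>)\<close> and Cauchy-Schwarz forces \<open>\<beta> = \<alpha>\<close>. What is special to the classical types is
  that a positive root of the length of a leaf \<open>\<alpha>\<close> has \<open>\<alpha>\<close>-coefficient at most 1; this is read
  off the invariant quadratic form, written as a sum of integer squares.
\<close>

subsection \<open>Words in reflections\<close>

lemma linear_reflection: "linear (reflection \<beta>)"
  unfolding reflection_def
  by (intro linearI) (simp_all add: inner_add_left algebra_simps add_divide_distrib)

lemma reflection_eq_cartan: "reflection \<beta> v = v - cartan_number v \<beta> *\<^sub>R \<beta>"
  by (simp add: reflection_def cartan_number_def)

lemma reflection_self: "reflection \<beta> \<beta> = - \<beta>"
  by (cases "\<beta> = 0") (simp_all add: reflection_def scaleR_2)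

lemma reflection_orthogonal: "v \<bullet> \<beta> = 0 \<Longrightarrow> reflection \<beta> v = v"
  by (simp add: reflection_def)

lemma reflection_involution [simp]: "reflection \<beta> (reflection \<beta> v) = v"
  by (cases "\<beta> = 0") (simp_all add: reflection_def algebra_simps)

lemma reflection_isometry [simp]: "reflection \<beta> v \<bullet> reflection \<beta> w = v \<bullet> w"
  by (cases "\<beta> = 0") (simp_all add: reflection_def algebra_simps inner_commute)

lemma norm_reflection [simp]: "norm (reflection \<beta> v) = norm v"
  by (simp add: norm_eq_sqrt_inner)

text \<open>An isometry carries the mirror of \<open>\<delta>\<close> to that of
  \<open>f \<delta>\<close>. Conjugation is written as an intertwining relation, so no inverse of
  \<open>f\<close> occurs.\<close>

lemma reflection_conjugate:
  assumes "linear f" "\<And>x y. f x \<bullet> f y = x \<bullet> y"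
  shows "f (reflection \<delta> v) = reflection (f \<delta>) (f v)"
  by (simp add: reflection_def linear_diff[OF assms(1)] linear_scale[OF assms(1)] assms(2))

text \<open>Words stand in for abstract group elements: their length serves as an induction measure
  and reversal gives inverses. The head of the list acts last.\<close>

fun reflection_word :: "'a::euclidean_space list \<Rightarrow> 'a \<Rightarrow> 'a" where
  "reflection_word [] = id"
| "reflection_word (x # xs) = reflection x \<circ> reflection_word xs"

lemma reflection_word_append:
  "reflection_word (xs @ ys) = reflection_word xs \<circ> reflection_word ys"
  by (induction xs) (simp_all add: comp_assoc)

lemma linear_reflection_word: "linear (reflection_word xs)"
proof (induction xs)
  case Nil
  show ?case
    by (simp only: reflection_word.simps linear_id)
next
  case (Cons x xs)
  show ?case
    by (simp only: reflection_word.simps linear_compose[OF Cons linear_reflection])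
qed

lemma reflection_word_isometry [simp]: "reflection_word xs v \<bullet> reflection_word xs w = v \<bullet> w"
  by (induction xs) simp_all

lemma norm_reflection_word [simp]: "norm (reflection_word xs v) = norm v"
  by (simp add: norm_eq_sqrt_inner)

lemma reflection_word_rev [simp]: "reflection_word (rev xs) (reflection_word xs v) = v"
  by (induction xs) (simp_all add: reflection_word_append)

lemma reflection_word_rev' [simp]: "reflection_word xs (reflection_word (rev xs) v) = v"
  using reflection_word_rev[of "rev xs"] by simp

lemma bij_reflection: "bij (reflection \<beta>)"
  by (rule o_bij[where g = "reflection \<beta>"]) (simp_all add: fun_eq_iff)

text \<open>Reflections are involutions, so inverses add no new generators and products of
  generators exhaust the group.\<close>

lemma parabolic_eq_words: "parabolic \<Delta> X = {reflection_word xs |xs. set xs \<subseteq> \<Delta> - X}"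
proof -
  let ?B = "BijGroup (UNIV :: 'a set)" and ?W = "{reflection_word xs |xs. set xs \<subseteq> \<Delta> - X}"
  have carrier: "reflection \<beta> \<in> carrier ?B" for \<beta> :: 'a
    using bij_reflection by (simp add: BijGroup_def Bij_def)
  have mult: "f \<otimes>\<^bsub>?B\<^esub> g = f \<circ> g" if "f \<in> carrier ?B" "g \<in> carrier ?B" for f g
    using that by (simp add: BijGroup_def compose_def comp_def restrict_def)
  have one: "\<one>\<^bsub>?B\<^esub> = id"
    by (simp add: BijGroup_def id_def restrict_def)
  have inv: "inv\<^bsub>?B\<^esub> (reflection \<beta>) = reflection \<beta>" for \<beta> :: 'a
    by (rule group.inv_equality[OF group_BijGroup])
      (simp_all add: carrier mult one fun_eq_iff)
  \<comment> \<open>Carrier membership is carried along because multiplication in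
    \<open>BijGroup\<close> is composition only on the carrier.\<close>
  have words: "reflection_word xs \<in> carrier ?B \<and> reflection_word xs \<in> parabolic \<Delta> X"
    if "set xs \<subseteq> \<Delta> - X" for xs
    using that
  proof (induction xs)
    case Nil
    show ?case
      using generate.one[of ?B "reflection ` (\<Delta> - X)"]
        monoid.one_closed[OF group.is_monoid[OF group_BijGroup[of "UNIV :: 'a set"]]]
      unfolding parabolic_def one reflection_word.simps by blast
  next
    case (Cons x xs)
    then have IH: "reflection_word xs \<in> carrier ?B" "reflection_word xs \<in> parabolic \<Delta> X"
      by auto
    have "reflection x \<in> parabolic \<Delta> X"
      unfolding parabolic_def using Cons.prems by (intro generate.incl) auto
    with IH(2) have "reflection x \<otimes>\<^bsub>?B\<^esub> reflection_word xs \<in> parabolic \<Delta> X"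
      unfolding parabolic_def by (rule generate.eng[rotated])
    moreover have "reflection x \<otimes>\<^bsub>?B\<^esub> reflection_word xs \<in> carrier ?B"
      using carrier IH(1) by (intro monoid.m_closed group.is_monoid group_BijGroup)
    ultimately show ?case
      unfolding mult[OF carrier IH(1)] reflection_word.simps by blast
  qed
  have "w \<in> ?W" if "w \<in> parabolic \<Delta> X" for w
    using that unfolding parabolic_def
  proof (induction rule: generate.induct)
    case one
    have "reflection_word [] \<in> ?W"
      by (auto intro!: exI[of _ "[]"])
    then show ?case
      unfolding \<open>\<one>\<^bsub>?B\<^esub> = id\<close> reflection_word.simps .
  next
    case (incl h)
    then obtain \<beta> where "\<beta> \<in> \<Delta> - X" "h = reflection \<beta>" by auto
    then show ?case
      by (auto intro!: exI[of _ "[\<beta>]"])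
  next
    case (inv h)
    then obtain \<beta> where "\<beta> \<in> \<Delta> - X" "h = reflection \<beta>" by auto
    then show ?case
      using \<open>\<And>\<beta>. inv\<^bsub>?B\<^esub> (reflection \<beta>) = reflection \<beta>\<close>
      by (auto intro!: exI[of _ "[\<beta>]"])
  next
    case (eng h1 h2)
    then obtain xs ys where "h1 = reflection_word xs" "set xs \<subseteq> \<Delta> - X"
      "h2 = reflection_word ys" "set ys \<subseteq> \<Delta> - X" by auto
    then show ?case
      using words by (auto simp: mult reflection_word_append intro!: exI[of _ "xs @ ys"])
  qed
  with words show ?thesis
    by auto
qed

subsection \<open>Coordinates of roots\<close>

locale based_root_system =
  fixes \<Phi> \<Delta> :: "'a::euclidean_space set"
  assumes root_system: "root_system \<Phi>"
    and simple_system: "simple_system \<Phi> \<Delta>"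
begin

text \<open>\<open>representation\<close> is 0 outside the span of its basis, so most facts below
  are stated for roots, which lie in the span.\<close>

abbreviation "simple_coeff \<equiv> representation \<Delta>"

lemma finite_roots: "finite \<Phi>"
  and zero_not_root: "0 \<notin> \<Phi>"
  and reflection_root: "\<beta> \<in> \<Phi> \<Longrightarrow> \<gamma> \<in> \<Phi> \<Longrightarrow> reflection \<beta> \<gamma> \<in> \<Phi>"
  and scaled_root: "\<beta> \<in> \<Phi> \<Longrightarrow> c *\<^sub>R \<beta> \<in> \<Phi> \<Longrightarrow> c = 1 \<or> c = - 1"
  and cartan_Ints: "\<beta> \<in> \<Phi> \<Longrightarrow> \<gamma> \<in> \<Phi> \<Longrightarrow> cartan_number \<beta> \<gamma> \<in> \<int>"
  using root_system unfolding root_system_def by blast+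

lemma root_inner_pos: "\<beta> \<in> \<Phi> \<Longrightarrow> 0 < \<beta> \<bullet> \<beta>"
  using zero_not_root by auto

lemma simple_root: "\<delta> \<in> \<Delta> \<Longrightarrow> \<delta> \<in> \<Phi>"
  and independent_simple: "independent \<Delta>"
  and root_sign: "\<beta> \<in> \<Phi> \<Longrightarrow> nonneg_combination \<Delta> \<beta> \<or> nonneg_combination \<Delta> (- \<beta>)"
  using simple_system unfolding simple_system_def by blast+

lemma finite_simple: "finite \<Delta>"
  using independent_simple by (rule independent_imp_finite)

lemma uminus_root: "\<beta> \<in> \<Phi> \<Longrightarrow> - \<beta> \<in> \<Phi>"
  using reflection_root[of \<beta> \<beta>] by (simp add: reflection_self)

lemma coeff_sum:
  assumes "\<delta> \<in> \<Delta>"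
  shows "simple_coeff (\<Sum>\<epsilon>\<in>\<Delta>. f \<epsilon> *\<^sub>R \<epsilon>) \<delta> = f \<delta>"
proof -
  have "simple_coeff (\<Sum>\<epsilon>\<in>\<Delta>. f \<epsilon> *\<^sub>R \<epsilon>) = (\<lambda>b. \<Sum>\<epsilon>\<in>\<Delta>. simple_coeff (f \<epsilon> *\<^sub>R \<epsilon>) b)"
    by (intro representation_sum independent_simple span_scale span_base)
  then show ?thesis
    using assms finite_simple
    by (simp add: representation_scale representation_basis independent_simple span_base if_distrib
        sum.delta cong: if_cong)
qed

lemma root_span: "\<beta> \<in> \<Phi> \<Longrightarrow> \<beta> \<in> span \<Delta>"
proof -
  have "v \<in> span \<Delta>" if "nonneg_combination \<Delta> v" for v
    using that by (auto simp: nonneg_combination_def intro!: span_sum span_scale intro: span_base)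
  moreover assume "\<beta> \<in> \<Phi>"
  ultimately show ?thesis
    using root_sign[of \<beta>] span_neg[of "- \<beta>"] by auto
qed

lemma root_expansion: "\<beta> \<in> \<Phi> \<Longrightarrow> (\<Sum>\<delta>\<in>\<Delta>. simple_coeff \<beta> \<delta> *\<^sub>R \<delta>) = \<beta>"
  by (intro sum_representation_eq independent_simple root_span finite_simple) auto

lemma inner_expansion: "\<beta> \<in> \<Phi> \<Longrightarrow> v \<bullet> \<beta> = (\<Sum>\<delta>\<in>\<Delta>. simple_coeff \<beta> \<delta> * (v \<bullet> \<delta>))"
  by (subst root_expansion[symmetric], assumption) (simp add: inner_sum_right)

lemma coeff_uminus: "\<beta> \<in> \<Phi> \<Longrightarrow> simple_coeff (- \<beta>) \<delta> = - simple_coeff \<beta> \<delta>"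
  by (simp add: representation_neg independent_simple root_span)

lemma coeff_simple: "\<delta> \<in> \<Delta> \<Longrightarrow> simple_coeff \<delta> \<epsilon> = (if \<epsilon> = \<delta> then 1 else 0)"
  by (auto simp: representation_basis independent_simple)

text \<open>Only a multiple of \<open>\<delta>\<close> is subtracted, so all other coordinates are
  invariant. This drives the positivity of reflected roots, the descent in height and the constancy
  of the \<open>\<alpha>\<close>-coefficient along orbits.\<close>

lemma coeff_reflection:
  assumes "\<beta> \<in> \<Phi>" "\<delta> \<in> \<Delta>"
  shows "simple_coeff (reflection \<delta> \<beta>) \<epsilon> = simple_coeff \<beta> \<epsilon> - (if \<epsilon> = \<delta> then cartan_number \<beta> \<delta> else 0)"
  using assms
  by (simp add: reflection_eq_cartan representation_diff representation_scale independent_simple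
      root_span span_base span_scale coeff_simple)

lemma coeff_Ints:
  assumes "\<beta> \<in> \<Phi>" "\<delta> \<in> \<Delta>"
  shows "simple_coeff \<beta> \<delta> \<in> \<int>"
proof -
  have "simple_coeff v \<delta> \<in> \<int>" if "nonneg_combination \<Delta> v" for v
    using that assms by (auto simp: nonneg_combination_def coeff_sum)
  from this[of \<beta>] this[of "- \<beta>"] show ?thesis
    using root_sign[OF assms(1)] by (auto simp: coeff_uminus assms)
qed

lemma coeff_sign:
  assumes "\<beta> \<in> \<Phi>"
  shows "(\<forall>\<delta>\<in>\<Delta>. simple_coeff \<beta> \<delta> \<ge> 0) \<or> (\<forall>\<delta>\<in>\<Delta>. simple_coeff \<beta> \<delta> \<le> 0)"
proof -
  have "\<forall>\<delta>\<in>\<Delta>. simple_coeff v \<delta> \<ge> 0" if "nonneg_combination \<Delta> v" for v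
    using that assms by (auto simp: nonneg_combination_def coeff_sum)
  from this[of \<beta>] this[of "- \<beta>"] show ?thesis
    using root_sign[OF assms(1)] by (auto simp: coeff_uminus assms)
qed

section \<open>Positive roots under simple reflections\<close>

lemma positive_roots_iff: "\<beta> \<in> positive_roots \<Phi> \<Delta> \<longleftrightarrow> \<beta> \<in> \<Phi> \<and> (\<forall>\<delta>\<in>\<Delta>. simple_coeff \<beta> \<delta> \<ge> 0)"
proof (intro iffI)
  assume "\<beta> \<in> positive_roots \<Phi> \<Delta>"
  then show "\<beta> \<in> \<Phi> \<and> (\<forall>\<delta>\<in>\<Delta>. simple_coeff \<beta> \<delta> \<ge> 0)"
    by (auto simp: positive_roots_def nonneg_combination_def coeff_sum)
next
  assume \<beta>: "\<beta> \<in> \<Phi> \<and> (\<forall>\<delta>\<in>\<Delta>. simple_coeff \<beta> \<delta> \<ge> 0)"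
  \<comment> \<open>Integrality lets the floor recover the natural coefficients that
    \<open>nonneg_combination\<close> demands.\<close>
  have "real (nat \<lfloor>simple_coeff \<beta> \<delta>\<rfloor>) = simple_coeff \<beta> \<delta>" if "\<delta> \<in> \<Delta>" for \<delta>
    using \<beta> that coeff_Ints[of \<beta> \<delta>] by (auto elim!: Ints_cases)
  then have "(\<Sum>\<delta>\<in>\<Delta>. real (nat \<lfloor>simple_coeff \<beta> \<delta>\<rfloor>) *\<^sub>R \<delta>) = (\<Sum>\<delta>\<in>\<Delta>. simple_coeff \<beta> \<delta> *\<^sub>R \<delta>)"
    by (intro sum.cong) (simp_all only:)
  also have "\<dots> = \<beta>"
    using root_expansion \<beta> by blast
  finally have "\<beta> = (\<Sum>\<delta>\<in>\<Delta>. real (nat \<lfloor>simple_coeff \<beta> \<delta>\<rfloor>) *\<^sub>R \<delta>)" ..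
  with \<beta> show "\<beta> \<in> positive_roots \<Phi> \<Delta>"
    unfolding positive_roots_def nonneg_combination_def
    by (intro CollectI conjI exI[of _ "\<lambda>\<delta>. nat \<lfloor>simple_coeff \<beta> \<delta>\<rfloor>"]) auto
qed

text \<open>The coefficients of a root never have mixed signs, so one strictly positive coefficient
  decides.\<close>

lemma positiveI: "\<beta> \<in> \<Phi> \<Longrightarrow> \<delta> \<in> \<Delta> \<Longrightarrow> simple_coeff \<beta> \<delta> > 0 \<Longrightarrow> \<beta> \<in> positive_roots \<Phi> \<Delta>"
  using coeff_sign[of \<beta>] by (auto simp: positive_roots_iff not_le[symmetric])

lemma positive_or_negative:
  "\<beta> \<in> \<Phi> \<Longrightarrow> \<beta> \<in> positive_roots \<Phi> \<Delta> \<or> - \<beta> \<in> positive_roots \<Phi> \<Delta>"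
  using coeff_sign[of \<beta>] by (auto simp: positive_roots_iff coeff_uminus uminus_root)

lemma not_positive_and_negative:
  assumes "\<beta> \<in> positive_roots \<Phi> \<Delta>" "- \<beta> \<in> positive_roots \<Phi> \<Delta>"
  shows False
proof -
  have "\<beta> \<in> \<Phi>" "\<And>\<delta>. \<delta> \<in> \<Delta> \<Longrightarrow> simple_coeff \<beta> \<delta> = 0"
    using assms by (auto simp: positive_roots_iff coeff_uminus order_antisym)
  then show False
    using root_expansion[of \<beta>] zero_not_root by simp
qed

lemma simple_positive: "\<delta> \<in> \<Delta> \<Longrightarrow> \<delta> \<in> positive_roots \<Phi> \<Delta>"
  by (auto simp: positive_roots_iff simple_root coeff_simple)

text \<open>If only \<open>\<delta>\<close> occurred in \<open>\<beta>\<close>, then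
  \<open>\<beta>\<close> would be a multiple of \<open>\<delta>\<close>, and reducedness with
  positivity would leave \<open>\<delta>\<close> itself.\<close>

lemma positive_not_simple_support:
  assumes "\<beta> \<in> positive_roots \<Phi> \<Delta>" "\<delta> \<in> \<Delta>" "\<beta> \<noteq> \<delta>"
  obtains \<epsilon> where "\<epsilon> \<in> \<Delta>" "\<epsilon> \<noteq> \<delta>" "simple_coeff \<beta> \<epsilon> > 0"
proof (rule ccontr)
  assume "\<not> thesis"
  with that assms(1) have *: "simple_coeff \<beta> \<epsilon> = 0" if "\<epsilon> \<in> \<Delta>" "\<epsilon> \<noteq> \<delta>" for \<epsilon>
    using that by (force simp: positive_roots_iff)
  have \<beta>: "\<beta> \<in> \<Phi>" "simple_coeff \<beta> \<delta> \<ge> 0"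
    using assms by (auto simp: positive_roots_iff)
  have "\<beta> = (\<Sum>\<epsilon>\<in>\<Delta>. simple_coeff \<beta> \<epsilon> *\<^sub>R \<epsilon>)"
    using root_expansion \<beta> by simp
  also have "\<dots> = simple_coeff \<beta> \<delta> *\<^sub>R \<delta>"
    using * assms(2) finite_simple by (subst sum.remove[of _ \<delta>]) auto
  finally have eq: "\<beta> = simple_coeff \<beta> \<delta> *\<^sub>R \<delta>" .
  then have "simple_coeff \<beta> \<delta> = 1 \<or> simple_coeff \<beta> \<delta> = -1"
    using scaled_root[OF simple_root[OF assms(2)]] \<beta>(1) by metis
  then show False
    using eq \<beta>(2) assms(3) by auto
qed

text \<open>Some simple root other than \<open>\<delta>\<close> occurs in \<open>\<beta>\<close>;
  its positive coefficient survives the reflection and fixes the sign of the image.\<close>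

lemma reflection_positive:
  assumes "\<beta> \<in> positive_roots \<Phi> \<Delta>" "\<delta> \<in> \<Delta>" "\<beta> \<noteq> \<delta>"
  shows "reflection \<delta> \<beta> \<in> positive_roots \<Phi> \<Delta>"
proof -
  obtain \<epsilon> where "\<epsilon> \<in> \<Delta>" "\<epsilon> \<noteq> \<delta>" "simple_coeff \<beta> \<epsilon> > 0"
    using assms by (rule positive_not_simple_support)
  moreover have "\<beta> \<in> \<Phi>"
    using assms(1) by (simp add: positive_roots_iff)
  ultimately show ?thesis
    using assms(2) by (intro positiveI[of _ \<epsilon>]) (simp_all add: coeff_reflection reflection_root simple_root)
qed

text \<open>Reflecting \<open>\<delta>\<close> in \<open>\<epsilon>\<close> gives a positive root
  whose \<open>\<epsilon>\<close>-coefficient is minus the Cartan number of the pair.\<close>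

lemma inner_simple_nonpos:
  assumes "\<delta> \<in> \<Delta>" "\<epsilon> \<in> \<Delta>" "\<delta> \<noteq> \<epsilon>"
  shows "\<delta> \<bullet> \<epsilon> \<le> 0"
proof -
  have "simple_coeff (reflection \<epsilon> \<delta>) \<epsilon> \<ge> 0"
    using reflection_positive[OF simple_positive[OF assms(1)] assms(2,3)] assms(2)
    by (simp add: positive_roots_iff)
  then have "cartan_number \<delta> \<epsilon> \<le> 0"
    using assms by (simp add: coeff_reflection simple_root coeff_simple)
  then show ?thesis
    using root_inner_pos[OF simple_root[OF assms(2)]]
    by (simp add: cartan_number_def divide_le_0_iff)
qed

lemma reflection_word_root:
  "set xs \<subseteq> \<Phi> \<Longrightarrow> \<beta> \<in> \<Phi> \<Longrightarrow> reflection_word xs \<beta> \<in> \<Phi>"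
  by (induction xs) (simp_all add: reflection_root)

lemma coeff_reflection_word:
  assumes "set xs \<subseteq> \<Delta> - {\<alpha>}" "\<beta> \<in> \<Phi>"
  shows "simple_coeff (reflection_word xs \<beta>) \<alpha> = simple_coeff \<beta> \<alpha>"
  using assms(1)
proof (induction xs)
  case (Cons x xs)
  then have "reflection_word xs \<beta> \<in> \<Phi>"
    using assms(2) simple_root by (intro reflection_word_root) auto
  with Cons show ?case
    by (auto simp: coeff_reflection)
qed simp

text \<open>The usual height, truncated to a natural number so that it can serve as a well-founded
  measure; it equals the coefficient sum on positive roots.\<close>

definition height :: "'a \<Rightarrow> nat" where
  "height \<beta> = nat \<lfloor>\<Sum>\<delta>\<in>\<Delta>. simple_coeff \<beta> \<delta>\<rfloor>"

text \<open>The coefficient sum drops by \<open>cartan_number \<beta> \<delta>\<close>, which has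
  the sign of the inner product. Both roots are positive, so the truncation in \<open>height\<close>
  is harmless.\<close>

lemma height_reflection_less:
  assumes "\<beta> \<in> positive_roots \<Phi> \<Delta>" "\<delta> \<in> \<Delta>" "\<beta> \<noteq> \<delta>" "\<beta> \<bullet> \<delta> > 0"
  shows "height (reflection \<delta> \<beta>) < height \<beta>"
proof -
  have \<beta>: "\<beta> \<in> \<Phi>" and pos: "reflection \<delta> \<beta> \<in> positive_roots \<Phi> \<Delta>"
    using assms reflection_positive by (auto simp: positive_roots_iff)
  have real_height: "real (height \<gamma>) = (\<Sum>\<epsilon>\<in>\<Delta>. simple_coeff \<gamma> \<epsilon>)" if "\<gamma> \<in> positive_roots \<Phi> \<Delta>" for \<gamma>
  proof -
    have "(\<Sum>\<epsilon>\<in>\<Delta>. simple_coeff \<gamma> \<epsilon>) \<in> \<int>" "(\<Sum>\<epsilon>\<in>\<Delta>. simple_coeff \<gamma> \<epsilon>) \<ge> 0"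
      using that by (auto simp: positive_roots_iff coeff_Ints intro!: sum_nonneg)
    then show ?thesis
      unfolding height_def by (auto elim!: Ints_cases)
  qed
  have "real (height (reflection \<delta> \<beta>)) = real (height \<beta>) - cartan_number \<beta> \<delta>"
    using assms(1,2) pos \<beta> finite_simple
    by (simp add: real_height coeff_reflection sum_subtractf)
  moreover have "cartan_number \<beta> \<delta> > 0"
    using assms(4) root_inner_pos[OF simple_root[OF assms(2)]]
    unfolding cartan_number_def by (intro divide_pos_pos) simp_all
  ultimately show ?thesis
    by linarith
qed

text \<open>Expanding one factor of the positive number \<open>\<beta> \<bullet> \<beta>\<close>
  yields a simple \<open>\<delta>\<close> that occurs in \<open>\<beta>\<close> and has positive
  inner product with it, so reflecting in \<open>\<delta>\<close> lowers the height. The step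
  records that \<open>\<delta>\<close> occurs in \<open>\<beta>\<close>; hence no reflection in
  \<open>\<alpha>\<close> arises for roots without \<open>\<alpha>\<close>.\<close>

lemma positive_root_induct [consumes 1, case_names simple reflection]:
  assumes "\<beta> \<in> positive_roots \<Phi> \<Delta>"
    and base: "\<And>\<delta>. \<delta> \<in> \<Delta> \<Longrightarrow> P \<delta>"
    and step: "\<And>\<beta> \<delta>. \<lbrakk>\<beta> \<in> positive_roots \<Phi> \<Delta>; \<delta> \<in> \<Delta>; simple_coeff \<beta> \<delta> > 0; P (reflection \<delta> \<beta>)\<rbrakk> \<Longrightarrow> P \<beta>"
  shows "P \<beta>"
  using assms(1)
proof (induction \<beta> rule: measure_induct_rule[where f = height])
  case (less \<beta>)
  then have \<beta>: "\<beta> \<in> \<Phi>" "\<And>\<delta>. \<delta> \<in> \<Delta> \<Longrightarrow> simple_coeff \<beta> \<delta> \<ge> 0"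
    by (auto simp: positive_roots_iff)
  have "0 < \<beta> \<bullet> \<beta>"
    using \<beta>(1) zero_not_root by auto
  also have "\<dots> = (\<Sum>\<delta>\<in>\<Delta>. simple_coeff \<beta> \<delta> * (\<beta> \<bullet> \<delta>))"
    by (rule inner_expansion[OF \<beta>(1)])
  finally have "\<exists>\<delta>\<in>\<Delta>. simple_coeff \<beta> \<delta> * (\<beta> \<bullet> \<delta>) > 0"
    using sum_nonpos[of \<Delta> "\<lambda>\<delta>. simple_coeff \<beta> \<delta> * (\<beta> \<bullet> \<delta>)"] by (meson not_less)
  then obtain \<delta> where \<delta>: "\<delta> \<in> \<Delta>" "simple_coeff \<beta> \<delta> * (\<beta> \<bullet> \<delta>) > 0" ..
  then have *: "simple_coeff \<beta> \<delta> > 0" "\<beta> \<bullet> \<delta> > 0"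
    using \<beta>(2)[of \<delta>] by (auto simp: zero_less_mult_iff)
  show ?case
  proof (cases "\<beta> = \<delta>")
    case True
    then show ?thesis
      using base \<delta>(1) by simp
  next
    case False
    then show ?thesis
      using less \<delta>(1) * by (intro step[of \<beta> \<delta>]) (auto intro: height_reflection_less reflection_positive)
  qed
qed

subsection \<open>Stabilizer of a simple root\<close>

text \<open>Applied letter by letter, the word turns the positive root \<open>\<delta>\<close>
  negative at some letter. That letter must equal the current image of \<open>\<delta>\<close>, and
  by conjugation it cancels against the reflection in \<open>\<delta>\<close>. The remaining letters
  come from \<open>xs\<close>, so the shorter word stays in the same parabolic subgroup.\<close>

lemma exchange:
  assumes "set xs \<subseteq> \<Delta>" "\<delta> \<in> \<Delta>" "- reflection_word xs \<delta> \<in> positive_roots \<Phi> \<Delta>"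
  shows "\<exists>ys. set ys \<subseteq> set xs \<and> length ys < length xs \<and>
    reflection_word xs \<circ> reflection \<delta> = reflection_word ys"
  using assms(1,3)
proof (induction xs)
  case Nil
  then show ?case
    using not_positive_and_negative[OF simple_positive[OF assms(2)]] by simp
next
  case (Cons x xs)
  let ?\<gamma> = "reflection_word xs \<delta>"
  show ?case
  proof (cases "- ?\<gamma> \<in> positive_roots \<Phi> \<Delta>")
    case True
    moreover have "set xs \<subseteq> \<Delta>"
      using Cons.prems by simp
    ultimately obtain ys where "set ys \<subseteq> set xs" "length ys < length xs"
      "reflection_word xs \<circ> reflection \<delta> = reflection_word ys"
      using Cons.IH by blast
    then show ?thesis
      by (intro exI[of _ "x # ys"]) (auto simp: comp_assoc simp del: comp_apply)
  next
    case False
    have "?\<gamma> \<in> \<Phi>"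
      using Cons.prems assms(2) simple_root by (intro reflection_word_root) auto
    with False have "?\<gamma> \<in> positive_roots \<Phi> \<Delta>"
      using positive_or_negative by blast
    \<comment> \<open>The only positive root that the reflection in \<open>x\<close> makes negative
      is \<open>x\<close>.\<close>
    then have "?\<gamma> = x"
      using Cons.prems reflection_positive[of ?\<gamma> x] not_positive_and_negative[of "reflection x ?\<gamma>"]
      by auto
    then have "reflection x (reflection_word xs v) = reflection_word xs (reflection \<delta> v)" for v
      using reflection_conjugate[OF linear_reflection_word reflection_word_isometry, of xs \<delta> v]
      by simp
    then have "reflection_word (x # xs) \<circ> reflection \<delta> = reflection_word xs"
      by (simp add: fun_eq_iff)
    then show ?thesis
      using set_subset_Cons[of xs x] by (intro exI[of _ xs] conjI) (simp_all only: length_Cons lessI)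
  qed
qed

text \<open>Induction on the word length, looking at the last letter \<open>\<delta>\<close>. If the
  word keeps \<open>\<delta>\<close> positive, exchange shortens it. Otherwise invariance of the
  inner product forces \<open>\<delta>\<close> to be orthogonal to \<open>\<alpha>\<close>, and the
  letter can be split off.\<close>

lemma stabilizer_eq_words:
  assumes "set xs \<subseteq> \<Delta> - {\<alpha>}" "\<alpha> \<in> \<Delta>" "reflection_word xs \<alpha> = \<alpha>"
  shows "\<exists>ys. set ys \<subseteq> {\<delta>\<in>\<Delta>. \<delta> \<bullet> \<alpha> = 0} \<and> reflection_word xs = reflection_word ys"
  using assms(1,3)
proof (induction xs rule: length_induct)
  case (1 xs)
  show ?case
  proof (cases xs rule: rev_exhaust)
    case Nil
    then show ?thesis
      by (intro exI[of _ "[]"]) auto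
  next
    case (snoc xs' \<delta>)
    with 1 have \<delta>: "\<delta> \<in> \<Delta>" "\<delta> \<noteq> \<alpha>" and xs': "set xs' \<subseteq> \<Delta> - {\<alpha>}" and xs: "set xs \<subseteq> \<Delta>"
      by auto
    let ?\<gamma> = "reflection_word xs \<delta>"
    have \<gamma>: "?\<gamma> \<in> \<Phi>"
      using xs \<delta> simple_root by (intro reflection_word_root) auto
    have \<gamma>_coeff: "simple_coeff ?\<gamma> \<alpha> = 0"
      using 1 \<delta> by (simp add: coeff_reflection_word simple_root coeff_simple)
    have word_snoc: "reflection_word xs = reflection_word xs' \<circ> reflection \<delta>"
      unfolding snoc reflection_word_append reflection_word.simps comp_id ..
    show ?thesis
    proof (cases "?\<gamma> \<in> positive_roots \<Phi> \<Delta>")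
      case True
      \<comment> \<open>The last letter negates \<open>\<delta>\<close>, so \<open>xs'\<close> makes
        \<open>\<delta>\<close> negative, as \<open>exchange\<close> asks.\<close>
      have "reflection_word xs' \<delta> = - ?\<gamma>"
        by (simp add: word_snoc reflection_self linear_neg[OF linear_reflection_word])
      with True obtain ys where ys: "set ys \<subseteq> set xs'" "length ys < length xs'"
        "reflection_word xs' \<circ> reflection \<delta> = reflection_word ys"
        using exchange[of xs' \<delta>] xs' \<delta> by auto
      then show ?thesis
        using 1 xs' word_snoc snoc
        by (elim allE[of _ ys]) (auto simp: less_Suc_eq)
    next
      case False
      then have neg: "- ?\<gamma> \<in> positive_roots \<Phi> \<Delta>"
        using \<gamma> positive_or_negative by blast
      have "\<delta> \<bullet> \<alpha> = ?\<gamma> \<bullet> \<alpha>"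
        using 1(3) reflection_word_isometry[of xs \<delta> \<alpha>] by simp
      also have "\<dots> = (\<Sum>\<epsilon>\<in>\<Delta>. simple_coeff ?\<gamma> \<epsilon> * (\<alpha> \<bullet> \<epsilon>))"
        using inner_expansion[OF \<gamma>] by (simp add: inner_commute)
      \<comment> \<open>All coefficients of \<open>?\<gamma>\<close> are nonpositive, as are the
        inner products of \<open>\<alpha>\<close> with other simple roots; the positive
        \<open>\<alpha> \<bullet> \<alpha>\<close> enters with coefficient 0.\<close>
      also have "\<dots> \<ge> 0"
      proof (rule sum_nonneg)
        fix \<epsilon> assume \<epsilon>: "\<epsilon> \<in> \<Delta>"
        then have "simple_coeff ?\<gamma> \<epsilon> \<le> 0"
          using neg \<gamma> by (auto simp: positive_roots_iff coeff_uminus)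
        then show "simple_coeff ?\<gamma> \<epsilon> * (\<alpha> \<bullet> \<epsilon>) \<ge> 0"
          using inner_simple_nonpos[OF assms(2) \<epsilon>] \<gamma>_coeff
          by (cases "\<epsilon> = \<alpha>") (auto intro: mult_nonpos_nonpos)
      qed
      finally have orth: "\<delta> \<bullet> \<alpha> = 0"
        using inner_simple_nonpos[OF \<delta>(1) assms(2) \<delta>(2)] by simp
      then have "reflection \<delta> \<alpha> = \<alpha>"
        by (intro reflection_orthogonal) (simp add: inner_commute)
      then have "reflection_word xs' \<alpha> = \<alpha>"
        using 1(3) by (simp add: word_snoc)
      then obtain ys where "set ys \<subseteq> {\<delta>\<in>\<Delta>. \<delta> \<bullet> \<alpha> = 0}" "reflection_word xs' = reflection_word ys"
        using 1(1) xs' snoc by (metis length_append_singleton lessI)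
      with orth \<delta> word_snoc show ?thesis
        by (intro exI[of _ "ys @ [\<delta>]"]) (auto simp: reflection_word_append)
    qed
  qed
qed

text \<open>A word fixes the orthogonal complement of the span of \<open>\<Delta>\<close> pointwise,
  so it is determined by its restriction to \<open>\<Delta>\<close>, a map into the finite set
  \<open>\<Phi>\<close>. The complement enters because roots may fail to span the ambient
  space.\<close>

lemma finite_parabolic: "finite (parabolic \<Delta> X)"
proof -
  let ?W = "parabolic \<Delta> X"
  have "w ` \<Delta> \<subseteq> \<Phi>" if "w \<in> ?W" for w
    using that simple_root unfolding parabolic_eq_words
    by (auto intro!: reflection_word_root)
  then have "(\<lambda>w. restrict w \<Delta>) ` ?W \<subseteq> \<Delta> \<rightarrow>\<^sub>E \<Phi>"
    by (intro image_subsetI PiE_I) auto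
  moreover have "inj_on (\<lambda>w. restrict w \<Delta>) ?W"
  proof (rule inj_onI)
    fix w w' assume W: "w \<in> ?W" "w' \<in> ?W" and eq: "restrict w \<Delta> = restrict w' \<Delta>"
    obtain xs ys where w: "w = reflection_word xs" "set xs \<subseteq> \<Delta>" "w' = reflection_word ys" "set ys \<subseteq> \<Delta>"
      using W unfolding parabolic_eq_words by auto
    have orth: "reflection_word zs z = z" if "set zs \<subseteq> \<Delta>" "\<And>v. v \<in> span \<Delta> \<Longrightarrow> orthogonal z v" for zs z
      using that by (induction zs) (auto simp: orthogonal_def reflection_orthogonal span_base)
    show "w = w'"
    proof
      fix v
      obtain y z where yz: "y \<in> span \<Delta>" "\<And>v. v \<in> span \<Delta> \<Longrightarrow> orthogonal z v" "v = y + z"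
        using orthogonal_subspace_decomp_exists[of \<Delta> v] by blast
      have "w \<delta> = w' \<delta>" if "\<delta> \<in> \<Delta>" for \<delta>
        using eq that by (metis restrict_apply')
      then have "w y = w' y"
        using linear_eq_on[of w w' y \<Delta>] linear_reflection_word yz(1) w by auto
      moreover have "w z = w' z"
        using orth[of _ z] yz(2) w by metis
      ultimately show "w v = w' v"
        unfolding yz(3) w by (simp add: linear_add[OF linear_reflection_word])
    qed
  qed
  ultimately show ?thesis
    using finite_PiE[OF finite_simple, of "\<lambda>_. \<Phi>"] finite_roots
    by (meson finite_imageD finite_subset)
qed

text \<open>Orbit-stabilizer: the fibre of \<open>\<lambda>w. w \<alpha>\<close> over
  \<open>u \<alpha>\<close> is the left translate by \<open>u\<close> of the stabilizer, and the
  stabilizer is generated by the simple reflections orthogonal to \<open>\<alpha>\<close>.\<close>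

lemma card_parabolic_eq_orbit:
  assumes "\<alpha> \<in> \<Delta>"
  shows "card (parabolic \<Delta> {\<alpha>}) =
    card ((\<lambda>w. w \<alpha>) ` parabolic \<Delta> {\<alpha>}) * card (parabolic \<Delta> (closed_nbhd \<Delta> \<alpha>))"
proof -
  let ?W = "parabolic \<Delta> {\<alpha>}" and ?S = "parabolic \<Delta> (closed_nbhd \<Delta> \<alpha>)"
  let ?O = "(\<lambda>w. w \<alpha>) ` ?W"
  have perp: "\<Delta> - closed_nbhd \<Delta> \<alpha> = {\<delta>\<in>\<Delta>. \<delta> \<bullet> \<alpha> = 0}"
    by (auto simp: closed_nbhd_def)
  have perp_sub: "{\<delta>\<in>\<Delta>. \<delta> \<bullet> \<alpha> = 0} \<subseteq> \<Delta> - {\<alpha>}"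
    using root_inner_pos[OF simple_root[OF assms]] by auto
  have "reflection_word ys \<alpha> = \<alpha>" if "set ys \<subseteq> {\<delta>\<in>\<Delta>. \<delta> \<bullet> \<alpha> = 0}" for ys
    using that by (induction ys) (auto simp: reflection_orthogonal inner_commute)
  then have S: "?S = {w\<in>?W. w \<alpha> = \<alpha>}"
    unfolding parabolic_eq_words perp using stabilizer_eq_words[OF _ assms] perp_sub by blast
  have comp: "v \<circ> w \<in> ?W" if W: "v \<in> ?W" "w \<in> ?W" for v w
  proof -
    obtain xs ys where "v = reflection_word xs" "set xs \<subseteq> \<Delta> - {\<alpha>}"
      "w = reflection_word ys" "set ys \<subseteq> \<Delta> - {\<alpha>}"
      using W unfolding parabolic_eq_words by blast
    then have "v \<circ> w = reflection_word (xs @ ys)" "set (xs @ ys) \<subseteq> \<Delta> - {\<alpha>}"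
      unfolding reflection_word_append by auto
    then show ?thesis
      unfolding parabolic_eq_words by blast
  qed
  have inv: "\<exists>w'\<in>?W. w' \<circ> w = id \<and> w \<circ> w' = id" if "w \<in> ?W" for w
    using that unfolding parabolic_eq_words
    by (force simp: fun_eq_iff intro: exI[of _ "rev _"])
  have fibre: "card {w\<in>?W. w \<alpha> = \<gamma>} = card ?S" if "\<gamma> \<in> ?O" for \<gamma>
  proof -
    from that obtain u where u: "u \<in> ?W" "\<gamma> = u \<alpha>" by auto
    obtain u' where u': "u' \<in> ?W" "u' \<circ> u = id" "u \<circ> u' = id"
      using inv[OF u(1)] by blast
    have "bij_betw (\<lambda>w. u \<circ> w) ?S {w\<in>?W. w \<alpha> = \<gamma>}"
    proof (rule bij_betw_byWitness[where f' = "\<lambda>w. u' \<circ> w"])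
      show "(\<lambda>w. u \<circ> w) ` ?S \<subseteq> {w\<in>?W. w \<alpha> = \<gamma>}"
        using comp u unfolding S by auto
      show "(\<lambda>w. u' \<circ> w) ` {w\<in>?W. w \<alpha> = \<gamma>} \<subseteq> ?S"
        using comp[OF u'(1)] u'(2) u(2) unfolding S by (auto simp: fun_eq_iff)
    qed (auto simp: comp_assoc[symmetric] u')
    then show ?thesis
      by (simp add: bij_betw_same_card)
  qed
  have "card ?W = (\<Sum>\<gamma>\<in>?O. card {w\<in>?W. w \<alpha> = \<gamma>})"
    using sum.image_gen[of ?W "\<lambda>_. 1::nat" "\<lambda>w. w \<alpha>"] finite_parabolic by simp
  also have "\<dots> = card ?O * card ?S"
    by (simp add: fibre)
  finally show ?thesis .
qed

subsection \<open>The orbit of a simple root\<close>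

text \<open>The right-hand side is itself a root system containing
  \<open>\<Delta> - {\<alpha>}\<close>, which bounds the hull. Conversely, every positive root
  without \<open>\<alpha>\<close> is reached from a simple one by reflections in simple roots other
  than \<open>\<alpha>\<close>.\<close>

lemma generated_subsystem_eq:
  assumes "\<alpha> \<in> \<Delta>"
  shows "generated_subsystem \<Phi> (\<Delta> - {\<alpha>}) = {\<beta>\<in>\<Phi>. simple_coeff \<beta> \<alpha> = 0}" (is "?G = ?R")
proof
  have "simple_coeff (reflection \<beta> \<gamma>) \<alpha> = 0" if "\<beta> \<in> ?R" "\<gamma> \<in> ?R" for \<beta> \<gamma>
    using that by (simp add: reflection_eq_cartan representation_diff representation_scale
        independent_simple root_span span_scale)
  then have "root_system ?R"
    using finite_roots zero_not_root reflection_root scaled_root cartan_Ints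
    unfolding root_system_def mem_Collect_eq by (intro conjI ballI allI impI) (simp | blast)+
  then show "?G \<subseteq> ?R"
    unfolding generated_subsystem_def
    by (intro hull_minimal) (auto simp: simple_root coeff_simple)
  show "?R \<subseteq> ?G"
    unfolding generated_subsystem_def hull_def
  proof (intro subsetI InterI, elim CollectE conjE)
    fix \<beta> \<Psi> assume \<beta>: "\<beta> \<in> \<Phi>" "simple_coeff \<beta> \<alpha> = 0"
      and \<Psi>: "root_system \<Psi>" "\<Psi> \<subseteq> \<Phi>" "\<Delta> - {\<alpha>} \<subseteq> \<Psi>"
    have closed: "reflection \<delta> \<gamma> \<in> \<Psi>" if "\<delta> \<in> \<Psi>" "\<gamma> \<in> \<Psi>" for \<delta> \<gamma>
      using \<Psi>(1) that unfolding root_system_def by blast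
    have pos: "\<gamma> \<in> \<Psi>" if "\<gamma> \<in> positive_roots \<Phi> \<Delta>" "simple_coeff \<gamma> \<alpha> = 0" for \<gamma>
      using that
    proof (induction \<gamma> rule: positive_root_induct)
      case (simple \<delta>)
      then show ?case
        using \<Psi>(3) by (auto simp: coeff_simple)
    next
      case (reflection \<gamma> \<delta>)
      \<comment> \<open>As \<open>\<delta>\<close> occurs in \<open>\<gamma>\<close> and
        \<open>\<alpha>\<close> does not, the two differ.\<close>
      then have \<delta>: "\<delta> \<in> \<Psi>" "\<delta> \<noteq> \<alpha>" and "\<gamma> \<in> \<Phi>"
        using \<Psi>(3) by (auto simp: positive_roots_iff)
      with reflection have "reflection \<delta> \<gamma> \<in> \<Psi>"
        by (simp add: coeff_reflection)
      then show ?case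
        using closed[OF \<delta>(1)] reflection_involution[of \<delta> \<gamma>] by metis
    qed
    show "\<beta> \<in> \<Psi>"
      using positive_or_negative[OF \<beta>(1)]
    proof
      assume "- \<beta> \<in> positive_roots \<Phi> \<Delta>"
      then have "- \<beta> \<in> \<Psi>"
        using pos \<beta> by (simp add: coeff_uminus)
      then show ?thesis
        using closed[of "- \<beta>" "- \<beta>"] by (simp add: reflection_self)
    qed (use pos \<beta> in blast)
  qed
qed

text \<open>Words without \<open>\<alpha>\<close> preserve length and
  \<open>\<alpha>\<close>-coefficient. Conversely, reflections in simple roots that have positive
  inner product with \<open>\<beta>\<close> lower its height inside the right-hand set until only
  \<open>\<alpha>\<close> is left.\<close>

lemma orbit_eq_coeff_one:
  assumes "\<alpha> \<in> \<Delta>"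
  shows "(\<lambda>w. w \<alpha>) ` parabolic \<Delta> {\<alpha>} =
    {\<beta>\<in>\<Phi>. simple_coeff \<beta> \<alpha> = 1 \<and> norm \<beta> = norm \<alpha>}" (is "?O = ?R")
proof
  show "?O \<subseteq> ?R"
    using assms unfolding parabolic_eq_words
    by (auto simp: coeff_reflection_word simple_root coeff_simple intro!: reflection_word_root)
next
  have "\<beta> \<in> ?O" if "\<beta> \<in> ?R" for \<beta>
    using that
  proof (induction \<beta> rule: measure_induct_rule[where f = height])
    case (less \<beta>)
    then have \<beta>: "\<beta> \<in> \<Phi>" "simple_coeff \<beta> \<alpha> = 1" "norm \<beta> = norm \<alpha>"
      by auto
    then have pos: "\<beta> \<in> positive_roots \<Phi> \<Delta>"
      using assms by (intro positiveI[of \<beta> \<alpha>]) auto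
    show ?case
    proof (cases "\<exists>\<delta>\<in>\<Delta> - {\<alpha>}. \<beta> \<bullet> \<delta> > 0")
      case True
      then obtain \<delta> where \<delta>: "\<delta> \<in> \<Delta>" "\<delta> \<noteq> \<alpha>" "\<beta> \<bullet> \<delta> > 0" by auto
      then have "\<beta> \<noteq> \<delta>"
        using \<beta>(2) by (auto simp: coeff_simple)
      then have "reflection \<delta> \<beta> \<in> ?O"
        using \<beta> \<delta> pos
        by (intro less.IH height_reflection_less) (auto simp: coeff_reflection reflection_root simple_root)
      then obtain xs where "set xs \<subseteq> \<Delta> - {\<alpha>}" "reflection \<delta> \<beta> = reflection_word xs \<alpha>"
        unfolding parabolic_eq_words by auto
      then have "\<beta> = reflection_word (\<delta> # xs) \<alpha>" "set (\<delta> # xs) \<subseteq> \<Delta> - {\<alpha>}"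
        using \<delta> reflection_involution[of \<delta> \<beta>] by auto
      then show ?thesis
        unfolding parabolic_eq_words by blast
    next
      case False
      have "\<beta> \<bullet> \<beta> = \<beta> \<bullet> \<alpha> + (\<Sum>\<delta>\<in>\<Delta> - {\<alpha>}. simple_coeff \<beta> \<delta> * (\<beta> \<bullet> \<delta>))"
        using \<beta> assms finite_simple by (subst inner_expansion) (simp_all add: sum.remove)
      also have "\<dots> \<le> \<beta> \<bullet> \<alpha>"
        using False pos
        by (auto simp: positive_roots_iff not_less intro!: sum_nonpos mult_nonneg_nonpos)
      \<comment> \<open>Equal lengths turn the left side into twice
        \<open>\<beta> \<bullet> \<beta> - \<beta> \<bullet> \<alpha>\<close>.\<close>
      finally have "(\<beta> - \<alpha>) \<bullet> (\<beta> - \<alpha>) \<le> 0"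
        using \<beta>(3) by (simp add: inner_diff inner_commute norm_eq)
      then have "\<beta> = \<alpha>"
        using inner_gt_zero_iff[of "\<beta> - \<alpha>"] by (auto simp: not_less[symmetric])
      then have "\<beta> = reflection_word [] \<alpha>"
        by simp
      moreover have "set [] \<subseteq> \<Delta> - {\<alpha>}" by simp
      ultimately show ?thesis
        unfolding parabolic_eq_words by blast
    qed
  qed
  then show "?R \<subseteq> ?O" ..
qed

end

subsection \<open>The quadratic forms of the classical types\<close>

text \<open>Coefficient sequences are indexed from 1 and padded by \<open>c 0 = 0\<close>. The form of the chain of
  type A is then, up to scale, \<open>energy c n + (c n)\<^sup>2\<close>.\<close>

definition energy :: "(nat \<Rightarrow> int) \<Rightarrow> nat \<Rightarrow> int" where
  "energy c m = (\<Sum>i<m. (c (Suc i) - c i)\<^sup>2)"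

lemma abs_le_square_int: "\<bar>x\<bar> \<le> x\<^sup>2" for x :: int
  using mult_left_mono[of 1 "\<bar>x\<bar>" "\<bar>x\<bar>"] by (cases "x = 0") (auto simp: power2_eq_square)

lemma square_le_twoD: "x\<^sup>2 \<le> 2 \<Longrightarrow> \<bar>x\<bar> \<le> 1" for x :: int
  using mult_mono[of 2 "\<bar>x\<bar>" 2 "\<bar>x\<bar>"] by (force simp: power2_eq_square not_le)

text \<open>Passes from equal inner products, both integer multiples of the scale \<open>s\<close>,
  to an equation of integers.\<close>

lemma of_int_mult_left_cancel: "s > 0 \<Longrightarrow> s * of_int a = s * of_int b \<Longrightarrow> a = b" for s :: real
  by simp

lemma energy_Suc: "energy c (Suc m) = energy c m + (c (Suc m) - c m)\<^sup>2"
  by (simp add: energy_def)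

text \<open>Telescoping from the padding value 0: \<open>c m\<close> is the sum of its increments,
  and an integer is bounded in absolute value by its square.\<close>

lemma abs_last_le_energy: "c 0 = 0 \<Longrightarrow> \<bar>c m\<bar> \<le> energy c m"
proof (induction m)
  case (Suc m)
  then show ?case
    using abs_le_square_int[of "c (Suc m) - c m"] by (simp add: energy_Suc)
qed (simp add: energy_def)

text \<open>Because of the padding, the first increment is \<open>c 1\<close> itself.\<close>

lemma first_square_le_energy:
  assumes "c 0 = 0" "1 \<le> m"
  shows "(c 1)\<^sup>2 \<le> energy c m"
  using member_le_sum[of 0 "{..<m}" "\<lambda>i. (c (Suc i) - c i)\<^sup>2"] assms
  by (simp add: energy_def)

text \<open>Only the last vertex of the chain meets \<open>u\<close>. For \<open>m = 0\<close> the
  sum is empty and the padding makes the right side vanish.\<close>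

lemma inner_chain_end:
  fixes v :: "nat \<Rightarrow> 'a::real_inner"
  assumes "c 0 = (0::int)" "\<forall>i\<in>{1..m}. v i \<bullet> u = (if i = m then t else 0)"
  shows "(\<Sum>i=1..m. of_int (c i) *\<^sub>R v i) \<bullet> u = of_int (c m) * t"
proof -
  have "(\<Sum>i=1..m. of_int (c i) *\<^sub>R v i) \<bullet> u = (\<Sum>i=1..m. if i = m then of_int (c i) * t else 0)"
    unfolding inner_sum_left using assms(2) by (intro sum.cong) auto
  then show ?thesis
    using assms(1) by (cases "m = 0") auto
qed

lemma inner_add_scaled_self:
  fixes p w :: "'a::real_inner"
  shows "(p + a *\<^sub>R w) \<bullet> (p + a *\<^sub>R w) = p \<bullet> p + 2 * a * (p \<bullet> w) + a\<^sup>2 * (w \<bullet> w)"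
  by (simp add: inner_add inner_commute[of w p] power2_eq_square algebra_simps)

text \<open>Completing squares along the chain: a new vertex replaces the boundary term
  \<open>(c m)\<^sup>2\<close> by \<open>(c (Suc m) - c m)\<^sup>2 + (c (Suc m))\<^sup>2\<close>.
  The scale \<open>s\<close> is half the common squared length.\<close>

lemma chain_square:
  fixes v :: "nat \<Rightarrow> 'a::real_inner"
  assumes "c 0 = 0"
    and "\<forall>i\<in>{1..m}. \<forall>j\<in>{1..m}. v i \<bullet> v j = s * of_int (cartan_A i j)"
  shows "(\<Sum>i=1..m. of_int (c i) *\<^sub>R v i) \<bullet> (\<Sum>i=1..m. of_int (c i) *\<^sub>R v i) =
    s * of_int (energy c m + (c m)\<^sup>2)"
  using assms(2)
proof (induction m)
  case 0
  then show ?case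
    by (simp add: energy_def assms(1))
next
  case (Suc m)
  let ?p = "\<Sum>i=1..m. of_int (c i) *\<^sub>R v i"
  have "?p \<bullet> v (Suc m) = of_int (c m) * (- s)"
    using Suc.prems by (intro inner_chain_end assms(1)) (auto simp: cartan_A_def)
  moreover have "?p \<bullet> ?p = s * of_int (energy c m + (c m)\<^sup>2)"
    using Suc by auto
  moreover have "v (Suc m) \<bullet> v (Suc m) = 2 * s"
    using Suc.prems by (auto simp: cartan_A_def)
  moreover have "(\<Sum>i=1..Suc m. of_int (c i) *\<^sub>R v i) = ?p + of_int (c (Suc m)) *\<^sub>R v (Suc m)"
    by simp
  ultimately show ?case
    by (simp only: inner_add_scaled_self) (simp add: energy_Suc power2_eq_square algebra_simps)
qed

text \<open>Common to types B and C: the length of the root after the chain and its inner product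
  \<open>t\<close> with the last chain root are left open.\<close>

lemma chain_snoc_square:
  fixes v :: "nat \<Rightarrow> 'a::real_inner"
  assumes "c 0 = 0"
    and "\<forall>i\<in>{1..m}. \<forall>j\<in>{1..m}. v i \<bullet> v j = s * of_int (cartan_A i j)"
    and "\<forall>i\<in>{1..m}. v i \<bullet> v (Suc m) = (if i = m then t else 0)"
  shows "(\<Sum>i=1..Suc m. of_int (c i) *\<^sub>R v i) \<bullet> (\<Sum>i=1..Suc m. of_int (c i) *\<^sub>R v i) =
    s * of_int (energy c m + (c m)\<^sup>2) + 2 * t * of_int (c m) * of_int (c (Suc m))
    + (v (Suc m) \<bullet> v (Suc m)) * (of_int (c (Suc m)))\<^sup>2"
proof -
  let ?p = "\<Sum>i=1..m. of_int (c i) *\<^sub>R v i"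
  have "(\<Sum>i=1..Suc m. of_int (c i) *\<^sub>R v i) = ?p + of_int (c (Suc m)) *\<^sub>R v (Suc m)"
    by simp
  then show ?thesis
    by (simp only: inner_add_scaled_self chain_square[of c, OF assms(1,2)] inner_chain_end[of c, OF assms(1,3)])
      (simp add: algebra_simps)
qed

text \<open>Equality of lengths reads \<open>energy c n + (c n)\<^sup>2 = 2\<close>. The squares of
  both end coefficients are bounded by this sum.\<close>

lemma type_A_bound:
  fixes v :: "nat \<Rightarrow> 'a::real_inner"
  assumes "c 0 = 0" "s > 0" "n \<ge> 1"
    and gram: "\<forall>i\<in>{1..n}. \<forall>j\<in>{1..n}. v i \<bullet> v j = s * of_int (cartan_A i j)"
    and "b = (\<Sum>i=1..n. of_int (c i) *\<^sub>R v i)" "b \<bullet> b = v k \<bullet> v k"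
    and "k = 1 \<or> k = n"
  shows "\<bar>c k\<bar> \<le> 1"
proof -
  have "k \<in> {1..n}"
    using assms(3,7) by auto
  then have "s * of_int 2 = s * of_int (energy c n + (c n)\<^sup>2)"
    using chain_square[of c n v s, OF assms(1) gram] gram[rule_format, of k k] assms(5,6)
    by (simp add: cartan_A_def)
  then have "energy c n + (c n)\<^sup>2 = 2"
    using of_int_mult_left_cancel[OF assms(2), of 2] by metis
  moreover have "(c 1)\<^sup>2 \<le> energy c n"
    using assms(1,3) by (rule first_square_le_energy)
  ultimately have "(c k)\<^sup>2 \<le> 2"
    using assms(7) zero_le_power2[of "c n"] zero_le_power2[of "c 1"] by (elim disjE; hypsubst; linarith)
  then show ?thesis
    by (rule square_le_twoD)
qed

text \<open>The short last root completes the square, so the form is \<open>s\<close> times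
  \<open>energy c (Suc m)\<close>, with value 2 at the long end and 1 at the short end. The first
  increment bounds the former case, telescoping the latter.\<close>

lemma type_B_bound:
  fixes v :: "nat \<Rightarrow> 'a::real_inner"
  assumes "c 0 = 0" "s > 0" "m \<ge> 1"
    and gram: "\<forall>i\<in>{1..m}. \<forall>j\<in>{1..m}. v i \<bullet> v j = s * of_int (cartan_A i j)"
    and last: "\<forall>i\<in>{1..m}. v i \<bullet> v (Suc m) = (if i = m then - s else 0)"
      "v (Suc m) \<bullet> v (Suc m) = s"
    and "b = (\<Sum>i=1..Suc m. of_int (c i) *\<^sub>R v i)" "b \<bullet> b = v k \<bullet> v k"
    and "k = 1 \<or> k = Suc m"
  shows "\<bar>c k\<bar> \<le> 1"
proof -
  have "b \<bullet> b = s * of_int (energy c (Suc m))"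
    unfolding assms(7) chain_snoc_square[of c m v s, OF assms(1) gram last(1)] last(2)
    by (simp add: energy_Suc power2_eq_square algebra_simps)
  moreover have "v k \<bullet> v k = s * of_int (if k = 1 then 2 else 1)"
    using assms(3,9) gram[rule_format, of 1 1] last(2) by (auto simp: cartan_A_def)
  ultimately have "energy c (Suc m) = (if k = 1 then 2 else 1)"
    using assms(2,8) by (intro of_int_mult_left_cancel[of s]) (simp_all only:)
  then show ?thesis
    using assms(9) first_square_le_energy[of c "Suc m", OF assms(1)] abs_last_le_energy[of c "Suc m", OF assms(1)]
      square_le_twoD[of "c 1"] assms(3) by auto
qed

text \<open>The form is \<open>s\<close> times
  \<open>energy c m + (2 * c (Suc m) - c m)\<^sup>2\<close>. Its value is 2 at the short end, where
  the first increment suffices, and 4 at the long end, where evenness allows division of the whole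
  equation by 4.\<close>

lemma type_C_bound:
  fixes v :: "nat \<Rightarrow> 'a::real_inner"
  assumes "c 0 = 0" "s > 0" "m \<ge> 1"
    and gram: "\<forall>i\<in>{1..m}. \<forall>j\<in>{1..m}. v i \<bullet> v j = s * of_int (cartan_A i j)"
    and last: "\<forall>i\<in>{1..m}. v i \<bullet> v (Suc m) = (if i = m then - 2 * s else 0)"
      "v (Suc m) \<bullet> v (Suc m) = 4 * s"
    and "b = (\<Sum>i=1..Suc m. of_int (c i) *\<^sub>R v i)" "b \<bullet> b = v k \<bullet> v k"
    and "k = 1 \<or> k = Suc m"
    and even: "k = Suc m \<Longrightarrow> \<forall>i\<in>{1..m}. even (c i)"
  shows "\<bar>c k\<bar> \<le> 1"
proof -
  have "b \<bullet> b = s * of_int (energy c m + (2 * c (Suc m) - c m)\<^sup>2)"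
    unfolding assms(7) chain_snoc_square[of c m v s, OF assms(1) gram last(1)] last(2)
    by (simp add: power2_eq_square algebra_simps)
  moreover have "v k \<bullet> v k = s * of_int (if k = 1 then 2 else 4)"
    using assms(3,9) gram[rule_format, of 1 1] last(2) by (auto simp: cartan_A_def)
  ultimately have E: "energy c m + (2 * c (Suc m) - c m)\<^sup>2 = (if k = 1 then 2 else 4)"
    using assms(2,8) by (intro of_int_mult_left_cancel[of s]) (simp_all only:)
  from assms(9) show ?thesis
  proof
    assume k: "k = 1"
    then have "energy c m + (2 * c (Suc m) - c m)\<^sup>2 = 2"
      using E by simp
    then have "(c 1)\<^sup>2 \<le> 2"
      using first_square_le_energy[of c, OF assms(1,3)] zero_le_power2[of "2 * c (Suc m) - c m"]
      by linarith
    then show ?thesis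
      unfolding k by (rule square_le_twoD)
  next
    assume k: "k = Suc m"
    \<comment> \<open>The halved sequence inherits the padding \<open>d 0 = 0\<close>, so
      telescoping applies to it as well.\<close>
    define d where "d i = c i div 2" for i
    have c: "c i = 2 * d i" if "i \<le> m" for i
      using even k that assms(1) by (cases "i = 0") (auto simp: d_def)
    have "energy c m = 4 * energy d m"
      using c by (auto simp: energy_def sum_distrib_left power2_eq_square algebra_simps intro!: sum.cong)
    then have "energy d m + (c (Suc m) - d m)\<^sup>2 = 1"
      using E k assms(3) c[of m] by (simp add: power2_eq_square algebra_simps)
    moreover have "\<bar>d m\<bar> \<le> energy d m"
      using assms(1) by (intro abs_last_le_energy) (simp add: d_def)
    ultimately show ?thesis
      using abs_le_square_int[of "c (Suc m) - d m"] k by simp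
  qed
qed

text \<open>Vertices up to \<open>Suc m\<close> form a chain; the last one is attached to the branch
  vertex \<open>m\<close>. The fork contributes the squares of \<open>?z - ?x - ?y\<close> and
  \<open>?y - ?x\<close>, and the whole sum of squares is 2.\<close>

lemma type_D_bound:
  fixes v :: "nat \<Rightarrow> 'a::real_inner"
  assumes "c 0 = 0" "s > 0" "m \<ge> 1"
    and gram: "\<forall>i\<in>{1..Suc m}. \<forall>j\<in>{1..Suc m}. v i \<bullet> v j = s * of_int (cartan_A i j)"
    and last: "\<forall>i\<in>{1..Suc m}. v i \<bullet> v (Suc (Suc m)) = (if i = m then - s else 0)"
      "v (Suc (Suc m)) \<bullet> v (Suc (Suc m)) = 2 * s"
    and b: "b = (\<Sum>i=1..Suc (Suc m). of_int (c i) *\<^sub>R v i)" "b \<bullet> b = v k \<bullet> v k"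
    and k: "k = 1 \<or> k = Suc m \<or> k = Suc (Suc m)"
  shows "\<bar>c k\<bar> \<le> 1"
proof -
  let ?x = "c (Suc m)" and ?y = "c (Suc (Suc m))" and ?z = "c m"
  let ?p = "\<Sum>i=1..Suc m. of_int (c i) *\<^sub>R v i" and ?w = "v (Suc (Suc m))"
  have "(\<Sum>i=1..m. of_int (c i) *\<^sub>R v i) \<bullet> ?w = of_int ?z * (- s)"
    using last(1) by (intro inner_chain_end assms(1)) auto
  then have "?p \<bullet> ?w = of_int ?z * (- s)"
    using last(1)[rule_format, of "Suc m"] by (simp add: inner_add_left)
  moreover have "?p \<bullet> ?p = s * of_int (energy c (Suc m) + ?x\<^sup>2)"
    by (rule chain_square[of c, OF assms(1) gram])
  moreover have "b = ?p + of_int ?y *\<^sub>R ?w"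
    unfolding b(1) by simp
  ultimately have "b \<bullet> b = s * of_int (energy c m + (?z - ?x - ?y)\<^sup>2 + (?y - ?x)\<^sup>2)"
    using last(2)
    by (simp only: inner_add_scaled_self) (simp add: energy_Suc power2_eq_square algebra_simps)
  moreover have "v k \<bullet> v k = s * of_int 2"
    using k gram[rule_format, of k k] last(2) by (auto simp: cartan_A_def)
  ultimately have E: "energy c m + (?z - ?x - ?y)\<^sup>2 + (?y - ?x)\<^sup>2 = 2"
    using assms(2) b(2) by (intro of_int_mult_left_cancel[of s]) (simp_all only:)
  show ?thesis
  proof (cases "k = 1")
    case True
    have "(c 1)\<^sup>2 \<le> 2"
      using E first_square_le_energy[of c, OF assms(1,3)] zero_le_power2[of "?z - ?x - ?y"]
        zero_le_power2[of "?y - ?x"]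
      by linarith
    then show ?thesis
      unfolding True by (rule square_le_twoD)
  next
    case False
    \<comment> \<open>Twice \<open>?x\<close> or \<open>?y\<close> is a signed sum of
      \<open>?z\<close>, \<open>?z - ?x - ?y\<close> and \<open>?y - ?x\<close>, whose absolute
      values add up to at most 2.\<close>
    then show ?thesis
      using E k abs_last_le_energy[of c m, OF assms(1)] abs_le_square_int[of "?z - ?x - ?y"]
        abs_le_square_int[of "?y - ?x"]
      by auto
  qed
qed

section \<open>From Cartan matrices to inner products\<close>

lemma inner_eq_cartan:
  "\<gamma> \<bullet> \<gamma> \<noteq> 0 \<Longrightarrow> \<beta> \<bullet> \<gamma> = cartan_number \<beta> \<gamma> * (\<gamma> \<bullet> \<gamma>) / 2"
  by (simp add: cartan_number_def)

text \<open>Adjacent roots of the chain have both Cartan numbers equal to -1, hence equal length, so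
  one scale serves the whole chain. In types B, C and D this is applied to an initial
  segment.\<close>

lemma cartan_A_gram:
  fixes v :: "nat \<Rightarrow> 'a::real_inner"
  assumes nz: "\<And>i. i \<in> {1..m} \<Longrightarrow> v i \<bullet> v i \<noteq> 0"
    and cartan: "\<And>i j. i \<in> {1..m} \<Longrightarrow> j \<in> {1..m} \<Longrightarrow> cartan_number (v i) (v j) = of_int (cartan_A i j)"
    and ij: "i \<in> {1..m}" "j \<in> {1..m}"
  shows "v i \<bullet> v j = (v 1 \<bullet> v 1) / 2 * of_int (cartan_A i j)"
proof -
  have same_norm: "v j \<bullet> v j = v 1 \<bullet> v 1" if "1 \<le> j" "j \<le> m" for j
    using that
  proof (induction j rule: nat_induct_at_least)
    case (Suc j)
    then have nz': "v j \<bullet> v j \<noteq> 0" "v (Suc j) \<bullet> v (Suc j) \<noteq> 0"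
      and minus1: "cartan_number (v j) (v (Suc j)) = - 1" "cartan_number (v (Suc j)) (v j) = - 1"
      using nz cartan by (simp_all add: cartan_A_def)
    then have "v (Suc j) \<bullet> v (Suc j) = v j \<bullet> v j"
      using inner_eq_cartan[OF nz'(1), of "v (Suc j)"] inner_eq_cartan[OF nz'(2), of "v j"]
        inner_commute[of "v j" "v (Suc j)"] unfolding minus1 by linarith
    with Suc show ?case
      by simp
  qed simp
  have eq: "v j \<bullet> v j = v 1 \<bullet> v 1"
    by (rule same_norm) (use ij in auto)
  have "v i \<bullet> v j = cartan_number (v i) (v j) * (v j \<bullet> v j) / 2"
    by (rule inner_eq_cartan[OF nz[OF ij(2)]])
  also have "\<dots> = (v 1 \<bullet> v 1) / 2 * of_int (cartan_A i j)"
    unfolding eq cartan[OF ij] by simp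
  finally show ?thesis .
qed

section \<open>Leaf coefficients in the classical types\<close>

context based_root_system
begin

text \<open>The Cartan number of a long root against a short one is twice the reverse Cartan number,
  so reflecting a long root changes its short coefficients by even amounts. In type C the quadratic
  form alone does not suffice for the long leaf: \<open>e\<^sub>1 + e\<^sub>2 + e\<^sub>3 + e\<^sub>4\<close> is as long as \<open>2e\<^sub>4\<close>
  but has coefficient 2.\<close>

lemma even_short_coeff:
  assumes "\<mu> \<in> \<Delta>" and ratio: "\<And>\<delta>. \<delta> \<in> \<Delta> \<Longrightarrow> \<delta> \<noteq> \<mu> \<Longrightarrow> \<mu> \<bullet> \<mu> = 2 * (\<delta> \<bullet> \<delta>)"
    and "\<beta> \<in> positive_roots \<Phi> \<Delta>" "\<beta> \<bullet> \<beta> = \<mu> \<bullet> \<mu>" "\<epsilon> \<in> \<Delta>" "\<epsilon> \<noteq> \<mu>"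
  shows "\<exists>z::int. simple_coeff \<beta> \<epsilon> = 2 * of_int z"
  using assms(3,4)
proof (induction \<beta> rule: positive_root_induct)
  case (simple \<delta>)
  then have "\<delta> = \<mu>"
    using ratio[of \<delta>] root_inner_pos[OF simple_root, of \<delta>] by force
  then show ?case
    using assms(1,6) by (intro exI[of _ 0]) (simp add: coeff_simple)
next
  case (reflection \<beta> \<delta>)
  then have \<beta>: "\<beta> \<in> \<Phi>"
    by (simp add: positive_roots_iff)
  obtain z :: int where z: "simple_coeff (reflection \<delta> \<beta>) \<epsilon> = 2 * of_int z"
    using reflection by auto
  show ?case
  proof (cases "\<epsilon> = \<delta>")
    case True
    then have "\<beta> \<bullet> \<beta> = 2 * (\<delta> \<bullet> \<delta>)"
      using reflection ratio assms by simp
    then have "cartan_number \<beta> \<delta> = 2 * cartan_number \<delta> \<beta>"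
      by (simp add: cartan_number_def inner_commute)
    moreover obtain y where "cartan_number \<delta> \<beta> = of_int y"
      using cartan_Ints[OF simple_root[OF reflection(2)] \<beta>] by (rule Ints_cases)
    ultimately show ?thesis
      using z True \<beta> reflection(2) by (intro exI[of _ "z + y"]) (simp add: coeff_reflection)
  next
    case False
    then show ?thesis
      using z \<beta> reflection(2) by (intro exI[of _ z]) (simp add: coeff_reflection)
  qed
qed

text \<open>The Cartan matrix determines all inner products up to scale and places the leaf at an
  end of the diagram; the bound for the respective type then applies to the integer coefficients of
  \<open>\<beta>\<close>.\<close>

lemma leaf_coeff_le_one:
  assumes "classical_type \<Delta>" "dynkin_leaf \<Delta> \<alpha>"
    and \<beta>: "\<beta> \<in> positive_roots \<Phi> \<Delta>" "norm \<beta> = norm \<alpha>"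
  shows "simple_coeff \<beta> \<alpha> \<le> 1"
proof -
  have \<beta>\<Phi>: "\<beta> \<in> \<Phi>"
    using \<beta>(1) by (simp add: positive_roots_iff)
  have \<alpha>: "\<alpha> \<in> \<Delta>" and card: "card {\<epsilon>\<in>\<Delta>. \<epsilon> \<noteq> \<alpha> \<and> \<epsilon> \<bullet> \<alpha> \<noteq> 0} = 1"
    using assms(2) by (auto simp: dynkin_leaf_def)
  obtain \<nu> where nbr: "{\<epsilon>\<in>\<Delta>. \<epsilon> \<noteq> \<alpha> \<and> \<epsilon> \<bullet> \<alpha> \<noteq> 0} = {\<nu>}"
    using card by (rule card_1_singletonE)
  have leaf: "\<delta> = \<epsilon>" if "\<delta> \<in> \<Delta>" "\<epsilon> \<in> \<Delta>" "\<delta> \<noteq> \<alpha>" "\<epsilon> \<noteq> \<alpha>" "\<delta> \<bullet> \<alpha> \<noteq> 0" "\<epsilon> \<bullet> \<alpha> \<noteq> 0" for \<delta> \<epsilon>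
  proof -
    have "\<delta> \<in> {\<nu>}" "\<epsilon> \<in> {\<nu>}"
      unfolding nbr[symmetric] using that by auto
    then show ?thesis by simp
  qed
  have norm: "\<beta> \<bullet> \<beta> = \<alpha> \<bullet> \<alpha>"
    using \<beta>(2) by (simp add: norm_eq)
  {
    \<comment> \<open>The matrix stays arbitrary here, so that numbering, coefficients and leaf
      position are treated once for all four types.\<close>
    fix n C assume "has_cartan_matrix \<Delta> n C"
    then obtain \<sigma> where \<sigma>: "bij_betw \<sigma> {1..n} \<Delta>"
      and cartan: "\<And>i j. i \<in> {1..n} \<Longrightarrow> j \<in> {1..n} \<Longrightarrow> cartan_number (\<sigma> i) (\<sigma> j) = of_int (C i j)"
      unfolding has_cartan_matrix_def by blast
    have simple: "\<sigma> i \<in> \<Delta>" if "i \<in> {1..n}" for i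
      using bij_betwE[OF \<sigma>] that by blast
    have inj: "\<sigma> i = \<sigma> j \<longleftrightarrow> i = j" if "i \<in> {1..n}" "j \<in> {1..n}" for i j
      by (rule inj_on_eq_iff[OF bij_betw_imp_inj_on[OF \<sigma>] that])
    have index: "\<exists>k\<in>{1..n}. \<sigma> k = \<delta>" if "\<delta> \<in> \<Delta>" for \<delta>
    proof -
      have "\<delta> \<in> \<sigma> ` {1..n}"
        unfolding bij_betw_imp_surj_on[OF \<sigma>] by (rule that)
      then show ?thesis
        by auto
    qed
    obtain k where k: "k \<in> {1..n}" "\<sigma> k = \<alpha>"
      using index[OF \<alpha>] by blast
    \<comment> \<open>The value at 0 is the padding that the sums of squares rely on; elsewhere the
      floor is exact by integrality.\<close>
    define c where "c i = (if i = 0 then 0 else \<lfloor>simple_coeff \<beta> (\<sigma> i)\<rfloor>)" for i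
    have c: "of_int (c i) = simple_coeff \<beta> (\<sigma> i)" if "i \<in> {1..n}" for i
      using coeff_Ints[OF \<beta>\<Phi> simple[OF that]] that by (auto simp: c_def elim!: Ints_cases)
    have "\<beta> = (\<Sum>i=1..n. simple_coeff \<beta> (\<sigma> i) *\<^sub>R \<sigma> i)"
      using root_expansion[OF \<beta>\<Phi>] sum.reindex_bij_betw[OF \<sigma>, of "\<lambda>\<delta>. simple_coeff \<beta> \<delta> *\<^sub>R \<delta>"] by simp
    also have "\<dots> = (\<Sum>i=1..n. of_int (c i) *\<^sub>R \<sigma> i)"
      by (intro sum.cong) (simp_all add: c)
    finally have expand: "\<beta> = (\<Sum>i=1..n. of_int (c i) *\<^sub>R \<sigma> i)" .
    have c_k: "simple_coeff \<beta> \<alpha> \<le> 1" if "\<bar>c k\<bar> \<le> 1"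
      using c[OF k(1)] that unfolding k(2) by linarith
    have one_nbr: "i = j"
      if "i \<in> {1..n}" "j \<in> {1..n}" "i \<noteq> k" "j \<noteq> k" "C i k \<noteq> 0" "C j k \<noteq> 0" for i j
    proof -
      have "cartan_number (\<sigma> i) \<alpha> \<noteq> 0" "cartan_number (\<sigma> j) \<alpha> \<noteq> 0"
        using cartan[OF that(1) k(1)] cartan[OF that(2) k(1)] that(5,6) unfolding k(2) by simp_all
      then have "\<sigma> i \<bullet> \<alpha> \<noteq> 0" "\<sigma> j \<bullet> \<alpha> \<noteq> 0"
        by (auto simp: cartan_number_def)
      moreover have "\<sigma> i \<noteq> \<alpha>" "\<sigma> j \<noteq> \<alpha>"
        using inj[OF that(1) k(1)] inj[OF that(2) k(1)] that(3,4) unfolding k(2) by simp_all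
      ultimately have "\<sigma> i = \<sigma> j"
        using leaf[OF simple simple] that(1,2) by blast
      then show ?thesis
        unfolding inj[OF that(1,2)] .
    qed
    have pos: "\<sigma> i \<bullet> \<sigma> i > 0" if "i \<in> {1..n}" for i
      using that by (intro root_inner_pos simple_root simple)
    have inner: "\<sigma> i \<bullet> \<sigma> j = of_int (C i j) * (\<sigma> j \<bullet> \<sigma> j) / 2" if "i \<in> {1..n}" "j \<in> {1..n}" for i j
      using inner_eq_cartan[of "\<sigma> j" "\<sigma> i"] pos[OF that(2)] cartan[OF that] by simp
    have c0: "c 0 = 0"
      by (simp add: c_def)
    have gram: "\<sigma> i \<bullet> \<sigma> j = (\<sigma> 1 \<bullet> \<sigma> 1) / 2 * of_int (cartan_A i j)"
      if "m \<le> n" "\<And>i j. i \<in> {1..m} \<Longrightarrow> j \<in> {1..m} \<Longrightarrow> C i j = cartan_A i j"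
        "i \<in> {1..m}" "j \<in> {1..m}" for m i j
      using that pos cartan by (intro cartan_A_gram[of m]) fastforce+
    \<comment> \<open>If the matrix joins \<open>k\<close> to its chain neighbours, an interior
      \<open>k\<close> has the two neighbours \<open>k - 1\<close> and \<open>k + 1\<close>, against
      the leaf condition.\<close>
    have ends: "k = 1 \<or> k = n" if "\<And>i. i \<in> {1..n} \<Longrightarrow> C i k = 0 \<Longrightarrow> cartan_A i k = 0"
    proof (rule ccontr)
      assume "\<not> ?thesis"
      then have "k - 1 \<in> {1..n}" "k + 1 \<in> {1..n}" "cartan_A (k - 1) k \<noteq> 0" "cartan_A (k + 1) k \<noteq> 0"
        using k(1) by (auto simp: cartan_A_def)
      then have "k - 1 = k + 1"
        using that k(1) by (intro one_nbr) auto
      then show False by simp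
    qed
    define s where "s = (\<sigma> 1 \<bullet> \<sigma> 1) / 2"
    have s: "s > 0" if "n \<ge> 1"
      using pos[of 1] that by (simp add: s_def)
    have norm': "\<beta> \<bullet> \<beta> = \<sigma> k \<bullet> \<sigma> k"
      unfolding k(2) by (rule norm)
    have A: "simple_coeff \<beta> \<alpha> \<le> 1" if C: "C = cartan_A" and n: "n \<ge> 1"
    proof -
      have g: "\<forall>i\<in>{1..n}. \<forall>j\<in>{1..n}. \<sigma> i \<bullet> \<sigma> j = s * of_int (cartan_A i j)"
        unfolding s_def by (intro ballI gram[of n]) (auto simp: C)
      have "k = 1 \<or> k = n"
        by (rule ends) (simp add: C)
      then show ?thesis
        by (intro c_k type_A_bound[where c = c and v = \<sigma> and k = k, OF c0 s[OF n] n g expand norm'])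
    qed
    have B: "simple_coeff \<beta> \<alpha> \<le> 1" if C: "C = cartan_B n" and n: "n \<ge> 2"
    proof -
      obtain m where m: "n = Suc m" "m \<ge> 1"
        using n by (cases n) auto
      have g: "\<forall>i\<in>{1..m}. \<forall>j\<in>{1..m}. \<sigma> i \<bullet> \<sigma> j = s * of_int (cartan_A i j)"
        unfolding s_def using m by (intro ballI gram[of m]) (auto simp: C cartan_B_def)
      have "\<sigma> m \<bullet> \<sigma> m = 2 * s"
        using g m by (simp add: cartan_A_def)
      \<comment> \<open>The two Cartan numbers of the last bond are used in turn: one gives the
        inner product from the known length of \<open>\<sigma> m\<close>, the other then gives the
        length of the last root.\<close>
      then have x: "\<sigma> (Suc m) \<bullet> \<sigma> m = - s"
        using inner[of n m] m by (simp add: C cartan_B_def cartan_A_def)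
      then have y: "\<sigma> (Suc m) \<bullet> \<sigma> (Suc m) = s"
        using inner[of m n] m inner_commute[of "\<sigma> m" "\<sigma> n"] by (simp add: C cartan_B_def)
      have last: "\<forall>i\<in>{1..m}. \<sigma> i \<bullet> \<sigma> (Suc m) = (if i = m then - s else 0)"
      proof
        fix i assume i: "i \<in> {1..m}"
        then have "\<sigma> i \<bullet> \<sigma> (Suc m) = of_int (C i n) * (\<sigma> (Suc m) \<bullet> \<sigma> (Suc m)) / 2"
          using inner[of i n] unfolding m(1) by simp
        moreover have "C i n = (if i = m then - 2 else 0)"
          using i by (auto simp: C cartan_B_def cartan_A_def m)
        ultimately show "\<sigma> i \<bullet> \<sigma> (Suc m) = (if i = m then - s else 0)"
          unfolding y by (cases "i = m") simp_all
      qed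
      have "k = 1 \<or> k = n"
        by (rule ends) (auto simp: C cartan_B_def split: if_splits)
      then show ?thesis
        unfolding m(1)
        by (intro c_k type_B_bound[where c = c and v = \<sigma> and k = k,
              OF c0 s m(2) g last y expand[unfolded m(1)] norm']) (simp_all add: m)
    qed
    have C: "simple_coeff \<beta> \<alpha> \<le> 1" if C: "C = cartan_C n" and n: "n \<ge> 2"
    proof -
      obtain m where m: "n = Suc m" "m \<ge> 1"
        using n by (cases n) auto
      have g: "\<forall>i\<in>{1..m}. \<forall>j\<in>{1..m}. \<sigma> i \<bullet> \<sigma> j = s * of_int (cartan_A i j)"
        unfolding s_def using m
        by (intro ballI gram[of m]) (auto simp: C cartan_C_def cartan_B_def cartan_A_def)
      have "\<sigma> m \<bullet> \<sigma> m = 2 * s"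
        using g m by (simp add: cartan_A_def)
      then have x: "\<sigma> (Suc m) \<bullet> \<sigma> m = - 2 * s"
        using inner[of n m] m by (simp add: C cartan_C_def cartan_B_def cartan_A_def)
      then have y: "\<sigma> (Suc m) \<bullet> \<sigma> (Suc m) = 4 * s"
        using inner[of m n] m inner_commute[of "\<sigma> m" "\<sigma> n"]
        by (simp add: C cartan_C_def cartan_B_def cartan_A_def)
      have last: "\<forall>i\<in>{1..m}. \<sigma> i \<bullet> \<sigma> (Suc m) = (if i = m then - 2 * s else 0)"
      proof
        fix i assume i: "i \<in> {1..m}"
        then have "\<sigma> i \<bullet> \<sigma> (Suc m) = of_int (C i n) * (\<sigma> (Suc m) \<bullet> \<sigma> (Suc m)) / 2"
          using inner[of i n] unfolding m(1) by simp
        moreover have "C i n = (if i = m then - 1 else 0)"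
          using i by (auto simp: C cartan_C_def cartan_B_def cartan_A_def m)
        ultimately show "\<sigma> i \<bullet> \<sigma> (Suc m) = (if i = m then - 2 * s else 0)"
          unfolding y by (cases "i = m") simp_all
      qed
      have "k = 1 \<or> k = n"
        by (rule ends) (auto simp: C cartan_C_def cartan_B_def cartan_A_def split: if_splits)
      \<comment> \<open>If the leaf is the long root, every other simple root has half its squared
        length, which is the setting of \<open>even_short_coeff\<close>.\<close>
      moreover have "\<forall>i\<in>{1..m}. even (c i)" if "k = Suc m"
      proof
        fix i assume i: "i \<in> {1..m}"
        have ratio: "\<alpha> \<bullet> \<alpha> = 2 * (\<delta> \<bullet> \<delta>)" if \<delta>: "\<delta> \<in> \<Delta>" "\<delta> \<noteq> \<alpha>" for \<delta>
        proof -
          obtain j where j: "j \<in> {1..n}" "\<sigma> j = \<delta>"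
            using index[OF \<delta>(1)] by blast
          then have "j \<noteq> k"
            using \<delta>(2) k(2) by auto
          then have "\<sigma> j \<bullet> \<sigma> j = 2 * s"
            using g j(1) m \<open>k = Suc m\<close> by (simp add: cartan_A_def)
          then show ?thesis
            using y unfolding k(2)[symmetric] j(2) \<open>k = Suc m\<close> by simp
        qed
        have "i \<in> {1..n}" "i \<noteq> k"
          using i m that by auto
        then have "\<sigma> i \<in> \<Delta>" "\<sigma> i \<noteq> \<alpha>"
          using simple inj[of i k] k by auto
        then obtain z :: int where "simple_coeff \<beta> (\<sigma> i) = 2 * of_int z"
          using even_short_coeff[OF \<alpha> ratio \<beta>(1) norm] by blast
        then have "real_of_int (c i) = of_int (2 * z)"
          using c[OF \<open>i \<in> {1..n}\<close>] by simp
        then have "c i = 2 * z"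
          by (simp only: of_int_eq_iff)
        then show "even (c i)"
          by simp
      qed
      ultimately show ?thesis
        unfolding m(1)
        by (intro c_k type_C_bound[where c = c and v = \<sigma> and k = k,
              OF c0 s m(2) g last y expand[unfolded m(1)] norm']) (simp_all add: m)
    qed
    have D: "simple_coeff \<beta> \<alpha> \<le> 1" if C: "C = cartan_D n" and n: "n \<ge> 4"
    proof -
      \<comment> \<open>\<open>m\<close> is the index of the branch vertex.\<close>
      define m where "m = n - 2"
      have m: "n = Suc (Suc m)" "m \<ge> 2" "m \<ge> 1"
        using n by (auto simp: m_def)
      have g: "\<forall>i\<in>{1..Suc m}. \<forall>j\<in>{1..Suc m}. \<sigma> i \<bullet> \<sigma> j = s * of_int (cartan_A i j)"
        unfolding s_def using m
        by (intro ballI gram[of "Suc m"]) (auto simp: C cartan_D_def cartan_A_def)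
      have "\<sigma> m \<bullet> \<sigma> m = 2 * s"
        using g m by (simp add: cartan_A_def)
      then have x: "\<sigma> (Suc (Suc m)) \<bullet> \<sigma> m = - s"
        using inner[of n m] m by (simp add: C cartan_D_def)
      then have y: "\<sigma> (Suc (Suc m)) \<bullet> \<sigma> (Suc (Suc m)) = 2 * s"
        using inner[of m n] m inner_commute[of "\<sigma> m" "\<sigma> n"] by (simp add: C cartan_D_def)
      have last: "\<forall>i\<in>{1..Suc m}. \<sigma> i \<bullet> \<sigma> (Suc (Suc m)) = (if i = m then - s else 0)"
      proof
        fix i assume i: "i \<in> {1..Suc m}"
        then have "\<sigma> i \<bullet> \<sigma> (Suc (Suc m)) = of_int (C i n) * (\<sigma> (Suc (Suc m)) \<bullet> \<sigma> (Suc (Suc m))) / 2"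
          using inner[of i n] unfolding m(1) by simp
        moreover have "C i n = (if i = m then - 1 else 0)"
          using i by (auto simp: C cartan_D_def m)
        ultimately show "\<sigma> i \<bullet> \<sigma> (Suc (Suc m)) = (if i = m then - s else 0)"
          unfolding y by (cases "i = m") simp_all
      qed
      \<comment> \<open>At the fork the consecutive indices \<open>Suc m\<close> and
        \<open>n\<close> are not joined, so \<open>ends\<close> does not apply as in the other
        types; an index strictly between 1 and \<open>Suc m\<close> still has both chain
        neighbours.\<close>
      have "k = 1 \<or> k = Suc m \<or> k = Suc (Suc m)"
      proof (rule ccontr)
        assume "\<not> ?thesis"
        then have "k - 1 = k + 1"
          using k(1) m by (intro one_nbr) (auto simp: C cartan_D_def)
        then show False by simp
      qed
      then show ?thesis
        unfolding m(1)
        by (intro c_k type_D_bound[where c = c and v = \<sigma> and k = k,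
              OF c0 s m(3) g last y expand[unfolded m(1)] norm']) (simp_all add: m)
    qed
    note A B C D
  }
  with assms(1) show ?thesis
    unfolding classical_type_def by blast
qed

text \<open>Lying outside the subsystem means a nonzero \<open>\<alpha>\<close>-coefficient, and an
  integer between 0 and 1 is then 1. Conversely, coefficient 1 makes a root positive.\<close>

lemma roots_outside_eq_orbit:
  assumes "classical_type \<Delta>" "dynkin_leaf \<Delta> \<alpha>"
  shows "{\<beta> \<in> positive_roots \<Phi> \<Delta> - generated_subsystem \<Phi> (\<Delta> - {\<alpha>}). norm \<beta> = norm \<alpha>}
    = (\<lambda>w. w \<alpha>) ` parabolic \<Delta> {\<alpha>}"
proof -
  have \<alpha>: "\<alpha> \<in> \<Delta>"
    using assms(2) by (simp add: dynkin_leaf_def)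
  have "simple_coeff \<beta> \<alpha> = 1"
    if "\<beta> \<in> positive_roots \<Phi> \<Delta>" "simple_coeff \<beta> \<alpha> \<noteq> 0" "norm \<beta> = norm \<alpha>" for \<beta>
  proof -
    have "simple_coeff \<beta> \<alpha> \<in> \<int>" "simple_coeff \<beta> \<alpha> \<ge> 0" "simple_coeff \<beta> \<alpha> \<le> 1"
      using that \<alpha> leaf_coeff_le_one[OF assms] by (auto simp: positive_roots_iff coeff_Ints)
    with that(2) show ?thesis
      by (auto elim!: Ints_cases)
  qed
  moreover have "\<beta> \<in> positive_roots \<Phi> \<Delta>" if "\<beta> \<in> \<Phi>" "simple_coeff \<beta> \<alpha> = 1" for \<beta>
    by (rule positiveI[OF that(1) \<alpha>]) (simp add: that)
  moreover have "positive_roots \<Phi> \<Delta> \<subseteq> \<Phi>"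
    by (auto simp: positive_roots_def)
  ultimately show ?thesis
    unfolding orbit_eq_coeff_one[OF \<alpha>] generated_subsystem_eq[OF \<alpha>] by auto
qed

end

theorem proposition8p2:
  fixes \<Phi> \<Delta> :: "'a::euclidean_space set" and \<alpha> :: 'a
  assumes "root_system \<Phi>"
    and "irreducible_roots \<Phi>"
    and "simple_system \<Phi> \<Delta>"
    and "classical_type \<Delta>"
    and "dynkin_leaf \<Delta> \<alpha>"
  shows "real (card {\<beta> \<in> positive_roots \<Phi> \<Delta> - generated_subsystem \<Phi> (\<Delta> - {\<alpha>}). norm \<beta> = norm \<alpha>})
       = real (card (parabolic \<Delta> {\<alpha>})) / real (card (parabolic \<Delta> (closed_nbhd \<Delta> \<alpha>)))"
proof -
  interpret based_root_system \<Phi> \<Delta>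
    using assms by unfold_locales
  have "\<alpha> \<in> \<Delta>"
    using assms(5) by (simp add: dynkin_leaf_def)
  \<comment> \<open>The identity makes the denominator nonzero, so the product formula may be
    divided.\<close>
  moreover have "reflection_word [] \<in> parabolic \<Delta> (closed_nbhd \<Delta> \<alpha>)"
    unfolding parabolic_eq_words by (intro CollectI exI[of _ "[]"]) simp
  then have "card (parabolic \<Delta> (closed_nbhd \<Delta> \<alpha>)) \<noteq> 0"
    using finite_parabolic by auto
  ultimately show ?thesis
    unfolding roots_outside_eq_orbit[OF assms(4,5)] by (simp add: card_parabolic_eq_orbit)
qed

end
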